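(* Let $\mu$ be a probability measure on the group $\mathbb{Z}_2^3$, and suppose that $a_{\max}=\mu(\{0\})$, where $a_{\max}=\max\{\mu(\{x\}):x\in\mathbb{Z}_2^3\}$. Then $\mu\in TEC(\mathbb{Z}_2^3)$ if and only if there exists a decomposition $$\mathbb{Z}_2^3=X_1\oplus X_2,\qquad X_1\in\mathfrak{A}_1,\ X_2\in\mathfrak{A}_2,$$ such that: in the case $a_{\max}\le 1/4$, both conditions I.1 and I.2 below are satisfied; and in the case $a_{\max}>1/4$, at least one of the conditions II.1, II.2, II.3, II.4 below is satisfied. **I.1.** The projection of $\mu$ on $X_2$ parallel to $X_1$ is equal to the Haar measure $m_{X_2}$ of $X_2$. **I.2.** At least one of the following three requirements is true: (a) the projection of $\mu$ on $X_1$ parallel to $X_2$ is equal to the Haar measure $m_{X_1}$ of $X_1$; (b) the sum of the masses (with respect to $\mu$) of some two elements of $X_2$ is equal to the sum of the masses of its other two elements; (c) let $K^{(j)}$, $j=1,2,3,4$, be all the subgroups in $\mathfrak{A}_2$ that do not contain $X_1$; there is $j_0\in\{1,2,3,4\}$ such that $\mu\in U(K^{(j_0)})$ and, for every $j\ne j_0$, the equality $u\big(\overline{K^{(j)}}\big)=\mu(\{z_j\})$ holds, where $z_j$ is the (unique) element with $z_j\in\overline{K^{(j)}}$, $z_j\notin X_1$, $z_j\notin K^{(j_0)}$. **II.1.** For every subgroup $K\in\mathfrak{A}_2$ the following two conditions are true: (a) $\mu\in U(K)$ or $\mu\in U(\overline{K})$; (b) $\mu\in V(K)$ or $\mu\in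 V(\overline{K})$. **II.2.** The following two conditions hold: (a) $\mu\in W(X_1,K)$ for at least one subgroup $K\in\mathfrak{A}_2$ that does not contain $X_1$; (b) $\mu\in U(K)$ or $\mu\in U(\overline{K})$ for every subgroup $K\in\mathfrak{A}_2$ that does not contain $X_1$. **II.3.** The following two conditions hold: (a) there is a two-point subset $E\subset X_2$ such that for both elements $g\in X_1$ one has $\mu(g+E)=\mu(g+(X_2\setminus E))$; (b) $\mu\in U(K)$ or $\mu\in U(\overline{K})$ for every subgroup $K\in\mathfrak{A}_2$ with $K\ne X_2$. **II.4.** The following three conditions hold: (a) the projection of $\mu$ on $X_1$ parallel to $X_2$ is equal to the Haar measure $m_{X_1}$ of $X_1$; (b) $\mu\in V(K)$ or $\mu\in V(\overline{K})$ for every subgroup $K\in\mathfrak{A}_2$ with $K\ne X_2$; (c) $\mu\in U(K)$ or $\mu\in U(\overline{K})$ for every subgroup $K\in\mathfrak{A}_2$.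
   Context: $\mathbb{Z}_2=\{0,1\}$ is the additive group of residues modulo 2, and $\mathbb{Z}_2^3$ is its third direct power, with zero element $0$. Its character group is identified with $\mathbb{Z}_2^3$ through $(x,y)=(-1)^{\alpha\xi+\beta\eta+\gamma\zeta}$ for $x=(\alpha,\beta,\gamma)$, $y=(\xi,\eta,\zeta)$. $M^1(\mathbb{Z}_2^3)$ is the set of probability measures on $\mathbb{Z}_2^3$. The characteristic function of $\mu\in M^1(\mathbb{Z}_2^3)$ is $\widehat{\mu}(y)=\sum_{x\in\mathbb{Z}_2^3}\mu(\{x\})(x,y)$. Measures $\mu,\nu\in M^1(\mathbb{Z}_2^3)$ are equivalent if $|\widehat{\nu}(y)|=|\widehat{\mu}(y)|$ for all $y$. The shift of $\mu$ by $x$ is $\mu_x(E)=\mu(E+x)$. A measure $\mu$ has a trivial equivalence class if every $\nu\in M^1(\mathbb{Z}_2^3)$ equivalent to $\mu$ is a shift $\mu_x$ of $\mu$ for some $x\in\mathbb{Z}_2^3$ (central symmetry $x\mapsto -x$ is the identity on this group, so it plays no role). $TEC(\mathbb{Z}_2^3)$ is the set of all $\mu\in M^1(\mathbb{Z}_2^3)$ that have a trivial equivalence class. $\mathfrak{A}_1$ is the set of all (seven) subgroups of $\mathbb{Z}_2^3$ isomorphic to $\mathbb{Z}_2$; $\mathfrak{A}_2$ is the set of all (seven) subgroups isomorphic to $\mathbb{Z}_2^2$. For $K\in\mathfrak{A}_2$, $\overline{K}=\mathbb{Z}_2^3\setminus K$ is the coset of $K$ different from $K$. Given $\mathbb{Z}_2^3=X_1\oplus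 X_2$, the projection of $\mu$ on $X_2$ parallel to $X_1$ is the image of $\mu$ under the map $x_1+x_2\mapsto x_2$ ($x_i\in X_i$); similarly for the projection on $X_1$ parallel to $X_2$. Haar measures are normalized to total mass 1, i.e. $m_{X_i}$ is the uniform distribution on $X_i$. For a (nonempty) subset $E\subset\mathbb{Z}_2^3$ and a given $\mu$, put $u(E)=\max\{\mu(\{x\}):x\in E\}$ and $v(E)=\min\{\mu(\{x\}):x\in E\}$. $U(E)$ is the set of $\mu\in M^1(\mathbb{Z}_2^3)$ with $2u(E)>\mu(E)$. $V(E)$ is the set of $\mu\in M^1(\mathbb{Z}_2^3)$ with $1/2+2v(E)<\mu(E)$. Definition of $W(H,K)$: let $H=\{0,g\}\in\mathfrak{A}_1$, $K\in\mathfrak{A}_2$, $K\cap H=\{0\}$. There are exactly three subgroups $L_1,L_2,L_3\in\mathfrak{A}_2$ containing $H$. For $i=1,2,3$ let $t_i$ be the element of $L_i$ that belongs to $\overline{K}$ with $t_i\ne g$, and let $s_i\in L_i$ be the element with $s_i\ne 0,g,t_i$; thus $L_i=\{0,g,s_i,t_i\}$ and $K=\{0,s_1,s_2,s_3\}$. Then $W(H,K)$ is the set of $\mu\in M^1(\mathbb{Z}_2^3)$ such that $\mu(\{0,t_i\})=\mu(\{g,s_i\})$ for $i=1,2,3$. For $X_1\in\mathfrak{A}_1$ there are exactly four subgroups in $\mathfrak{A}_2$ not containing $X_1$ (equivalently, meeting $X_1$ only in $0$), and for two different such subgroups $K^{(j)},K^{(j_0)}$ there is exactly one element $z_j\in\overline{K^{(j)}}$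 with $z_j\notin X_1$ and $z_j\notin K^{(j_0)}$. *)

theory Defs
  imports
    "HOL-Probability.Probability_Mass_Function"
    "HOL-Library.Z2"
    "HOL-Library.Product_Plus"
begin

instance bit :: finite
proof
  have "(UNIV :: bit set) \<subseteq> {0, 1}" by auto
  then show "finite (UNIV :: bit set)" by (rule finite_subset) simp
qed

text \<open>
  Probability measures on the finite group are probability mass functions; \<open>pmf \<mu> x\<close> is the
  mass of the one-point set \<open>{x}\<close> and \<open>measure_pmf.prob \<mu> E\<close> the mass of \<open>E\<close>.
\<close>

type_synonym z23 = "bit \<times> bit \<times> bit"


subsection \<open>Subgroups and decompositions\<close>

definition subgrp :: "'a::group_add set \<Rightarrow> bool" where
  "subgrp H \<longleftrightarrow> 0 \<in> H \<and> (\<forall>x\<in>H. \<forall>y\<in>H. x + y \<in> H) \<and> (\<forall>x\<in>H. - x \<in> H)"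

definition grp_isomorphic :: "'a::group_add set \<Rightarrow> 'b::group_add set \<Rightarrow> bool" where
  "grp_isomorphic G H \<longleftrightarrow>
     (\<exists>\<phi>. bij_betw \<phi> G H \<and> (\<forall>x\<in>G. \<forall>y\<in>G. \<phi> (x + y) = \<phi> x + \<phi> y))"

definition subgroups1 :: "z23 set set" ("\<AA>\<^sub>1") where
  "\<AA>\<^sub>1 = {H. subgrp H \<and> grp_isomorphic H (UNIV :: bit set)}"

definition subgroups2 :: "z23 set set" ("\<AA>\<^sub>2") where
  "\<AA>\<^sub>2 = {K. subgrp K \<and> grp_isomorphic K (UNIV :: (bit \<times> bit) set)}"

definition direct_sum :: "z23 set \<Rightarrow> z23 set \<Rightarrow> bool" where
  "direct_sum X1 X2 \<longleftrightarrow>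
     subgrp X1 \<and> subgrp X2 \<and> X1 \<inter> X2 = {0} \<and> {x1 + x2 | x1 x2. x1 \<in> X1 \<and> x2 \<in> X2} = UNIV"

text \<open>\<open>proj_on X Y\<close> is the projection on \<open>X\<close> parallel to \<open>Y\<close>; it is used only if
  \<open>direct_sum X Y\<close> or \<open>direct_sum Y X\<close>.\<close>

definition proj_on :: "z23 set \<Rightarrow> z23 set \<Rightarrow> z23 \<Rightarrow> z23" where
  "proj_on X Y z = (THE x. x \<in> X \<and> (\<exists>y\<in>Y. z = x + y))"

definition proj_measure :: "z23 set \<Rightarrow> z23 set \<Rightarrow> z23 pmf \<Rightarrow> z23 pmf" where
  "proj_measure X Y \<mu> = map_pmf (proj_on X Y) \<mu>"

definition haar :: "z23 set \<Rightarrow> z23 pmf" where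
  "haar X = pmf_of_set X"


subsection \<open>Characteristic functions and trivial equivalence classes\<close>

fun character :: "z23 \<Rightarrow> z23 \<Rightarrow> real" where
  "character (\<alpha>, \<beta>, \<gamma>) (\<xi>, \<eta>, \<zeta>) =
     (- 1) ^ (of_bit \<alpha> * of_bit \<xi> + of_bit \<beta> * of_bit \<eta> + of_bit \<gamma> * of_bit \<zeta> :: nat)"

definition charfun :: "z23 pmf \<Rightarrow> z23 \<Rightarrow> real" where
  "charfun \<mu> y = (\<Sum>x\<in>UNIV. pmf \<mu> x * character x y)"

definition equivalent :: "z23 pmf \<Rightarrow> z23 pmf \<Rightarrow> bool" where
  "equivalent \<mu> \<nu> \<longleftrightarrow> (\<forall>y. \<bar>charfun \<nu> y\<bar> = \<bar>charfun \<mu> y\<bar>)"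

text \<open>The mass of \<open>E\<close> under \<open>shift x \<mu>\<close> is the mass of \<open>E + x\<close> under \<open>\<mu>\<close>, since \<open>E + x\<close> is the
  preimage of \<open>E\<close> under \<open>\<lambda>y. y - x\<close>.\<close>

definition shift :: "z23 \<Rightarrow> z23 pmf \<Rightarrow> z23 pmf" where
  "shift x \<mu> = map_pmf (\<lambda>y. y - x) \<mu>"

definition TEC :: "z23 pmf set" where
  "TEC = {\<mu>. \<forall>\<nu>. equivalent \<mu> \<nu> \<longrightarrow> (\<exists>x. \<nu> = shift x \<mu>)}"


subsection \<open>The sets of measures in the criterion\<close>

text \<open>The definitions of \<open>u_max\<close>, \<open>v_min\<close>, \<open>U_set\<close> and \<open>V_set\<close> are meant for nonempty \<open>E\<close>.\<close>

definition u_max :: "z23 pmf \<Rightarrow> z23 set \<Rightarrow> real" where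
  "u_max \<mu> E = Max {pmf \<mu> x | x. x \<in> E}"

definition v_min :: "z23 pmf \<Rightarrow> z23 set \<Rightarrow> real" where
  "v_min \<mu> E = Min {pmf \<mu> x | x. x \<in> E}"

definition U_set :: "z23 set \<Rightarrow> z23 pmf set" where
  "U_set E = {\<mu>. 2 * u_max \<mu> E > measure_pmf.prob \<mu> E}"

definition V_set :: "z23 set \<Rightarrow> z23 pmf set" where
  "V_set E = {\<mu>. 1 / 2 + 2 * v_min \<mu> E < measure_pmf.prob \<mu> E}"

text \<open>\<open>W_set H K\<close> is meant for \<open>H \<in> \<AA>\<^sub>1\<close>, \<open>K \<in> \<AA>\<^sub>2\<close> with \<open>K \<inter> H = {0}\<close>. Then \<open>g\<close> is unique, and
  every \<open>L \<in> \<AA>\<^sub>2\<close> containing \<open>H\<close> determines \<open>t\<close> and \<open>s\<close>, with \<open>L = {0, g, s, t}\<close>.\<close>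

definition W_set :: "z23 set \<Rightarrow> z23 set \<Rightarrow> z23 pmf set" where
  "W_set H K =
     {\<mu>. \<forall>g L t s. H = {0, g} \<and> g \<noteq> 0 \<and> L \<in> \<AA>\<^sub>2 \<and> H \<subseteq> L \<and>
            t \<in> L \<and> t \<in> - K \<and> t \<noteq> g \<and> s \<in> L \<and> s \<notin> {0, g, t} \<longrightarrow>
            measure_pmf.prob \<mu> {0, t} = measure_pmf.prob \<mu> {g, s}}"

definition cond_I1 :: "z23 pmf \<Rightarrow> z23 set \<Rightarrow> z23 set \<Rightarrow> bool" where
  "cond_I1 \<mu> X1 X2 \<longleftrightarrow> proj_measure X2 X1 \<mu> = haar X2"

definition cond_I2a :: "z23 pmf \<Rightarrow> z23 set \<Rightarrow> z23 set \<Rightarrow> bool" where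
  "cond_I2a \<mu> X1 X2 \<longleftrightarrow> proj_measure X1 X2 \<mu> = haar X1"

definition cond_I2b :: "z23 pmf \<Rightarrow> z23 set \<Rightarrow> bool" where
  "cond_I2b \<mu> X2 \<longleftrightarrow>
     (\<exists>E\<subseteq>X2. card E = 2 \<and> measure_pmf.prob \<mu> E = measure_pmf.prob \<mu> (X2 - E))"

text \<open>In \<open>cond_I2c\<close> exactly one \<open>z\<close> satisfies the three membership conditions, for any two
  different subgroups \<open>K0\<close>, \<open>K\<close> as quantified there.\<close>

definition cond_I2c :: "z23 pmf \<Rightarrow> z23 set \<Rightarrow> bool" where
  "cond_I2c \<mu> X1 \<longleftrightarrow>
     (\<exists>K0\<in>\<AA>\<^sub>2. \<not> X1 \<subseteq> K0 \<and> \<mu> \<in> U_set K0 \<and>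
        (\<forall>K\<in>\<AA>\<^sub>2. \<not> X1 \<subseteq> K \<and> K \<noteq> K0 \<longrightarrow>
           (\<forall>z. z \<in> - K \<and> z \<notin> X1 \<and> z \<notin> K0 \<longrightarrow> u_max \<mu> (- K) = pmf \<mu> z)))"

definition cond_I2 :: "z23 pmf \<Rightarrow> z23 set \<Rightarrow> z23 set \<Rightarrow> bool" where
  "cond_I2 \<mu> X1 X2 \<longleftrightarrow> cond_I2a \<mu> X1 X2 \<or> cond_I2b \<mu> X2 \<or> cond_I2c \<mu> X1"

definition cond_II1 :: "z23 pmf \<Rightarrow> bool" where
  "cond_II1 \<mu> \<longleftrightarrow>
     (\<forall>K\<in>\<AA>\<^sub>2. (\<mu> \<in> U_set K \<or> \<mu> \<in> U_set (- K)) \<and> (\<mu> \<in> V_set K \<or> \<mu> \<in> V_set (- K)))"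

definition cond_II2 :: "z23 pmf \<Rightarrow> z23 set \<Rightarrow> bool" where
  "cond_II2 \<mu> X1 \<longleftrightarrow>
     (\<exists>K\<in>\<AA>\<^sub>2. \<not> X1 \<subseteq> K \<and> \<mu> \<in> W_set X1 K) \<and>
     (\<forall>K\<in>\<AA>\<^sub>2. \<not> X1 \<subseteq> K \<longrightarrow> \<mu> \<in> U_set K \<or> \<mu> \<in> U_set (- K))"

definition cond_II3 :: "z23 pmf \<Rightarrow> z23 set \<Rightarrow> z23 set \<Rightarrow> bool" where
  "cond_II3 \<mu> X1 X2 \<longleftrightarrow>
     (\<exists>E\<subseteq>X2. card E = 2 \<and>
        (\<forall>g\<in>X1. measure_pmf.prob \<mu> ((+) g ` E) = measure_pmf.prob \<mu> ((+) g ` (X2 - E)))) \<and>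
     (\<forall>K\<in>\<AA>\<^sub>2. K \<noteq> X2 \<longrightarrow> \<mu> \<in> U_set K \<or> \<mu> \<in> U_set (- K))"

definition cond_II4 :: "z23 pmf \<Rightarrow> z23 set \<Rightarrow> z23 set \<Rightarrow> bool" where
  "cond_II4 \<mu> X1 X2 \<longleftrightarrow>
     proj_measure X1 X2 \<mu> = haar X1 \<and>
     (\<forall>K\<in>\<AA>\<^sub>2. K \<noteq> X2 \<longrightarrow> \<mu> \<in> V_set K \<or> \<mu> \<in> V_set (- K)) \<and>
     (\<forall>K\<in>\<AA>\<^sub>2. \<mu> \<in> U_set K \<or> \<mu> \<in> U_set (- K))"

end

theory Submission
  imports Defs
begin

text \<open>
  By Fourier inversion the measures equivalent to \<open>\<mu>\<close> are the nonnegative functions obtained by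
  changing signs of values of the characteristic function, and shifts correspond to multiplying it
  by characters. Modulo characters there are $16$ sign patterns on the dual group: the trivial one,
  seven patterns \<open>flip s\<close> (only \<open>s\<close> changes sign), and eight patterns \<open>coflip s\<close> (everything except
  \<open>0\<close> and \<open>s\<close> changes sign). With \<open>K\<close> the annihilator of \<open>s\<close>, the pattern \<open>flip s\<close> produces a
  negative value iff \<open>\<mu>\<close> lies in \<open>V(K)\<close> or \<open>V(- K)\<close>, the pattern \<open>coflip s\<close> with \<open>s \<noteq> 0\<close> does so iff
  \<open>\<mu>\<close> lies in \<open>U(K)\<close> or \<open>U(- K)\<close>, and \<open>coflip 0\<close> does so iff some mass exceeds $1/4$. So \<open>\<mu>\<close> has a
  trivial equivalence class iff each of these patterns is infeasible or is, outside the zeros of the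
  characteristic function, a character.

  If the masses are at most $1/4$, \<open>coflip 0\<close> is feasible, which forces the characteristic function to
  vanish on a line of the Fano plane (I.1); modulo changes of sign on that line only one nontrivial
  class is left (I.2). If some mass exceeds $1/4$, the zeros contain no line, and the cases of no, one,
  two and at least three zeros give II.1, II.4, II.3 and II.2.
\<close>

subsection \<open>Characters and their kernels\<close>

lemma all_bit: "(\<forall>b::bit. P b) \<longleftrightarrow> P 0 \<and> P 1"
  by (metis bit.exhaust)

lemma card_bit [simp]: "CARD(bit) = 2"
proof -
  have "(UNIV :: bit set) = {0, 1}" by (intro UNIV_eq_I) (metis bit.exhaust insertI1 insertI2)
  then have "CARD(bit) = card {0, 1 :: bit}" by (rule arg_cong)
  then show ?thesis by simp
qed

lemma card_z23: "card (UNIV :: z23 set) = 8"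
  by simp

lemma uminus_z23 [simp]: "- x = (x::z23)"
  by (cases x) simp

lemma add_self_z23 [simp]: "x + x = (0::z23)"
  using left_minus[of x] by (simp only: uminus_z23)

lemma minus_z23 [simp]: "x - y = x + (y::z23)"
  by (simp only: diff_conv_add_uminus uminus_z23)

lemma add_add_self_z23 [simp]: "x + (x + y) = (y::z23)"
  by (simp flip: add.assoc)

lemma add_add_self2_z23 [simp]: "x + (y + x) = (y::z23)"
  by (simp add: add.commute[of y x])

lemma add_eq_0_z23 [simp]: "x + y = 0 \<longleftrightarrow> x = (y::z23)"
  by (metis add_add_self_z23 add.right_neutral add_self_z23)

lemma add_eq_iff_z23: "x + y = z \<longleftrightarrow> x = z + (y::z23)"
  by (auto simp: add.assoc)

lemma character_sq [simp]: "character x y * character x y = 1"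
  by (cases "(x, y)" rule: character.cases) (simp flip: power_mult_distrib)

lemma character_cases: "character x y = 1 \<or> character x y = - 1"
  using character_sq[of x y] square_eq_1_iff by blast

lemma character_neq [simp]: "character x y \<noteq> 1 \<longleftrightarrow> character x y = - 1"
  using character_cases[of x y] by auto

lemma character_nz [simp]: "character x y \<noteq> 0"
  using character_cases[of x y] by auto

lemma character_commute: "character x y = character y x"
  by (cases "(x, y)" rule: character.cases) (simp add: mult.commute)

lemma character_zero [simp]: "character 0 y = 1" "character y 0 = 1"
  by (cases y, simp add: zero_prod_def)+

lemma character_add_left: "character (x + x') y = character x y * character x' y"
proof -
  have *: "(- 1 :: real) ^ (of_bit (a + b) * of_bit c) = (- 1) ^ (of_bit a * of_bit c) * (- 1) ^ (of_bit b * of_bit c)" for a b c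
    by (cases a; cases b; cases c) auto
  show ?thesis
    by (cases x; cases x'; cases y) (simp only: add_Pair character.simps power_add *, simp only: mult_ac)
qed

lemma character_add_right: "character x (y + y') = character x y * character x y'"
  by (simp add: character_commute[of x] character_add_left)

text \<open>Two independent vectors over the field with two elements have a nonzero normal vector,
  which annihilates exactly their span. Since the group is identified with its dual, this serves
  both for four-element subgroups and for lines of the Fano plane of nonzero characters.\<close>

lemma ex_character_span:
  assumes "a \<noteq> 0" "b \<noteq> 0" "a \<noteq> b"
  obtains k where "k \<noteq> 0" "\<And>r. character r k = (if r \<in> {0, a, b, a + b} then 1 else - 1)"
proof -
  obtain a1 a2 a3 b1 b2 b3 where ab: "a = (a1, a2, a3)" "b = (b1, b2, b3)"
    by (cases a; cases b)
  \<comment> \<open>the cross product of \<open>a\<close> and \<open>b\<close>\<close>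
  define k where "k = (a2 * b3 + a3 * b2, a3 * b1 + a1 * b3, a1 * b2 + a2 * b1)"
  have "k \<noteq> 0 \<and> (\<forall>r. character r k = (if r \<in> {0, a, b, a + b} then 1 else - 1))"
    using assms unfolding ab k_def
    by (cases a1; cases a2; cases a3; cases b1; cases b2; cases b3; hypsubst)
      (simp_all add: zero_prod_def all_bit)
  then show ?thesis using that by blast
qed

declare split_paired_All [simp del] split_paired_Ex [simp del]

lemma ex_character_neg:
  assumes "s \<noteq> 0"
  obtains g where "character g s = - 1"
proof -
  obtain a b c where "s = (a, b, c)" by (cases s)
  with assms have "character (1,0,0) s = - 1 \<or> character (0,1,0) s = - 1 \<or> character (0,0,1) s = - 1"
    by (cases a; cases b; cases c) (simp_all add: zero_prod_def)
  then show ?thesis using that by blast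
qed

text \<open>From here on characters enter only through the facts proved so far, without
  coordinates.\<close>

declare character.simps [simp del]

text \<open>Translating by an element where the character is \<open>- 1\<close> negates the sum over
  the whole group.\<close>

lemma sum_character: "(\<Sum>x\<in>UNIV. character x y) = (if y = 0 then 8 else 0)"
proof (cases "y = 0")
  case True
  then show ?thesis by simp
next
  case False
  then obtain g where g: "character g y = - 1" using ex_character_neg by blast
  have "(\<Sum>x\<in>UNIV. character x y) = (\<Sum>x\<in>UNIV. character (x + g) y)"
    by (rule sum.reindex_bij_witness[of _ "\<lambda>x. x + g" "\<lambda>x. x + g"]) (simp_all add: add.assoc)
  also have "\<dots> = - (\<Sum>x\<in>UNIV. character x y)"
    by (simp add: character_add_left g sum_negf)
  finally show ?thesis using False by simp
qed

lemma ex_z23_notin: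
  assumes "card A < 8"
  shows "\<exists>w::z23. w \<notin> A"
  using assms card_z23 by (metis UNIV_eq_I less_irrefl)

text \<open>The annihilator of \<open>s\<close>. For \<open>s \<noteq> 0\<close> these sets are
  exactly the members of \<open>\<AA>\<^sub>2\<close>, as \<open>subgroups2_eq\<close> shows, so
  subgroups of order four are indexed by nonzero characters.\<close>

definition ker :: "z23 \<Rightarrow> z23 set" where
  "ker s = {x. character x s = 1}"

lemma mem_ker: "x \<in> ker s \<longleftrightarrow> character x s = 1"
  by (simp add: ker_def)

lemma not_mem_ker: "x \<notin> ker s \<longleftrightarrow> character x s = - 1"
  by (simp add: ker_def)

lemma card_ker:
  assumes "s \<noteq> 0"
  shows "card (ker s) = 4"
proof -
  have "(\<Sum>x\<in>UNIV. character x s) = (\<Sum>x\<in>UNIV. 2 * of_bool (x \<in> ker s) - 1)"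
    by (rule sum.cong) (use character_cases in \<open>auto simp: ker_def\<close>)
  also have "\<dots> = 2 * real (card (ker s)) - 8"
    by (simp add: sum_subtractf flip: sum_distrib_left)
  finally show ?thesis using assms by (simp add: sum_character)
qed

subsection \<open>Sign changes of the characteristic function\<close>

text \<open>Inverse Fourier transform of \<open>e\<close> times \<open>charfun \<mu>\<close>: the
  mass function that a measure with this characteristic function would have to have.\<close>

definition twist :: "z23 pmf \<Rightarrow> (z23 \<Rightarrow> real) \<Rightarrow> z23 \<Rightarrow> real" where
  "twist \<mu> e x = (\<Sum>y\<in>UNIV. e y * charfun \<mu> y * character x y) / 8"

definition feasible :: "z23 pmf \<Rightarrow> (z23 \<Rightarrow> real) \<Rightarrow> bool" where
  "feasible \<mu> e \<longleftrightarrow> (\<forall>x. twist \<mu> e x \<ge> 0)"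

text \<open>Equality modulo a character is demanded only where \<open>charfun \<mu>\<close> does not
  vanish, since signs at its zeros have no effect.\<close>

definition sim :: "z23 pmf \<Rightarrow> (z23 \<Rightarrow> real) \<Rightarrow> (z23 \<Rightarrow> real) \<Rightarrow> bool" where
  "sim \<mu> e e' \<longleftrightarrow> (\<exists>k. \<forall>y. charfun \<mu> y \<noteq> 0 \<longrightarrow> e y = character k y * e' y)"

definition admissible :: "z23 pmf \<Rightarrow> (z23 \<Rightarrow> real) \<Rightarrow> bool" where
  "admissible \<mu> e \<longleftrightarrow> (feasible \<mu> e \<longrightarrow> sim \<mu> e (\<lambda>_. 1))"

lemma simI:
  assumes "\<And>y. charfun \<mu> y \<noteq> 0 \<Longrightarrow> e y = character k y * e' y"
  shows "sim \<mu> e e'"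
  using assms unfolding sim_def by blast

lemma sim_refl: "sim \<mu> e e"
  by (rule simI[of _ _ 0]) simp

lemma sim_sym: "sim \<mu> e e' \<Longrightarrow> sim \<mu> e' e"
  unfolding sim_def by (metis character_sq mult.assoc mult_1)

lemma sim_trans:
  assumes "sim \<mu> e e'" "sim \<mu> e' e''"
  shows "sim \<mu> e e''"
proof -
  obtain k k' where k: "\<And>y. charfun \<mu> y \<noteq> 0 \<Longrightarrow> e y = character k y * e' y"
    "\<And>y. charfun \<mu> y \<noteq> 0 \<Longrightarrow> e' y = character k' y * e'' y"
    using assms unfolding sim_def by blast
  show ?thesis
    by (rule simI[of _ _ "k + k'"]) (simp add: k character_add_left)
qed

text \<open>A character factor on the Fourier side is a translation of the function itself; hence
  feasibility depends only on the class of a pattern under \<open>sim\<close>.\<close>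

lemma twist_shift:
  assumes "\<And>y. charfun \<mu> y \<noteq> 0 \<Longrightarrow> e y = character k y * e' y"
  shows "twist \<mu> e x = twist \<mu> e' (x + k)"
proof -
  have "e y * charfun \<mu> y * character x y = e' y * charfun \<mu> y * character (x + k) y" for y
    by (cases "charfun \<mu> y = 0") (simp_all add: assms character_add_left)
  then show ?thesis by (simp only: twist_def)
qed

lemma sim_feasible:
  assumes "sim \<mu> e e'" "feasible \<mu> e'"
  shows "feasible \<mu> e"
  using assms twist_shift unfolding sim_def feasible_def by metis

lemma sim_admissible:
  assumes "sim \<mu> e e'" "admissible \<mu> e'"
  shows "admissible \<mu> e"
  using assms sim_feasible sim_sym sim_trans unfolding admissible_def by metis


section \<open>Fourier inversion and the passage from equivalent measures to sign patterns\<close>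

lemma sum_pmf_z23: "(\<Sum>x\<in>UNIV. pmf \<mu> x) = (1::real)" for \<mu> :: "z23 pmf"
  by (rule sum_pmf_eq_1) auto

lemma charfun_zero [simp]: "charfun \<mu> 0 = 1"
  by (simp add: charfun_def sum_pmf_z23)

text \<open>Exchange the sums and use orthogonality. The function \<open>p\<close> is arbitrary
  because inversion is needed for mass functions as well as for functions on the dual group.\<close>

lemma fourier_inversion:
  "(\<Sum>y\<in>UNIV. (\<Sum>z\<in>UNIV. p z * character z y) * character x y) = 8 * p x"
proof -
  have "p z * character z y * character x y = p z * character y (z + x)" for y z
    by (simp add: character_commute[of y] character_add_left)
  then have "(\<Sum>y\<in>UNIV. (\<Sum>z\<in>UNIV. p z * character z y) * character x y)
      = (\<Sum>y\<in>UNIV. \<Sum>z\<in>UNIV. p z * character y (z + x))"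
    by (simp only: sum_distrib_right)
  also have "\<dots> = (\<Sum>z\<in>UNIV. p z * (\<Sum>y\<in>UNIV. character y (z + x)))"
    by (subst sum.swap) (simp only: sum_distrib_left)
  also have "\<dots> = (\<Sum>z\<in>UNIV. if z = x then 8 * p z else 0)"
    by (rule sum.cong) (simp_all add: sum_character)
  finally show ?thesis by simp
qed

lemma twist_one: "twist \<mu> (\<lambda>_. 1) x = pmf \<mu> x"
  using fourier_inversion[of "pmf \<mu>" x] by (simp add: twist_def charfun_def)

lemma charfun_inject: "charfun \<mu> = charfun \<nu> \<longleftrightarrow> \<mu> = \<nu>"
  by (metis (no_types, lifting) ext pmf_eqI twist_def twist_one)

lemma sum_translate: "(\<Sum>x\<in>UNIV. pmf \<mu> (x + k) * character x y) = character k y * charfun \<mu> y"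
proof -
  have "(\<Sum>x\<in>UNIV. pmf \<mu> (x + k) * character x y) = (\<Sum>x\<in>UNIV. pmf \<mu> x * character (x + k) y)"
    by (rule sum.reindex_bij_witness[of _ "\<lambda>x. x + k" "\<lambda>x. x + k"]) (simp_all add: add.assoc)
  then show ?thesis
    by (simp add: charfun_def character_add_left sum_distrib_left mult_ac)
qed

lemma charfun_shift: "charfun (shift k \<mu>) y = character k y * charfun \<mu> y"
proof -
  have *: "pmf (shift k \<mu>) x = pmf \<mu> (x + k)" for x
    using pmf_map_inj'[of "\<lambda>y. y + k" \<mu> "x + k"] by (simp add: shift_def inj_def add.assoc)
  show ?thesis unfolding charfun_def[of "shift k \<mu>"] * by (rule sum_translate)
qed

text \<open>Equivalent measures have characteristic functions whose ratio is a sign pattern, and a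
  shift is the case where this ratio is a character off the zeros.\<close>

lemma TEC_iff_signs:
  "\<mu> \<in> TEC \<longleftrightarrow> (\<forall>e. e 0 = 1 \<and> (\<forall>y. \<bar>e y\<bar> = 1) \<longrightarrow> admissible \<mu> e)"
proof
  assume \<mu>: "\<mu> \<in> TEC"
  show "\<forall>e. e 0 = 1 \<and> (\<forall>y. \<bar>e y\<bar> = 1) \<longrightarrow> admissible \<mu> e"
  proof (intro allI impI)
    fix e :: "z23 \<Rightarrow> real"
    assume e: "e 0 = 1 \<and> (\<forall>y. \<bar>e y\<bar> = 1)"
    show "admissible \<mu> e" unfolding admissible_def
    proof
      assume nn: "feasible \<mu> e"
      \<comment> \<open>Feasibility gives nonnegative masses and \<open>e 0 = 1\<close> gives total
        mass one, so the twisted masses form a measure.\<close>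
      define \<nu> where "\<nu> = embed_pmf (twist \<mu> e)"
      have cf: "(\<Sum>x\<in>UNIV. twist \<mu> e x * character x y) = e y * charfun \<mu> y" for y
        using fourier_inversion[of "\<lambda>y. e y * charfun \<mu> y" y]
        by (simp add: twist_def sum_divide_distrib[symmetric] character_commute)
      have "pmf \<nu> x = twist \<mu> e x" for x
        unfolding \<nu>_def
      proof (rule pmf_embed_pmf)
        show "0 \<le> twist \<mu> e x" for x using nn unfolding feasible_def by blast
        have "(\<Sum>x\<in>UNIV. twist \<mu> e x) = 1" using cf[of 0] e by simp
        then show "(\<integral>\<^sup>+ x. ennreal (twist \<mu> e x) \<partial>count_space UNIV) = 1"
          using nn by (simp add: nn_integral_count_space_finite sum_ennreal feasible_def)
      qed
      then have c\<nu>: "charfun \<nu> y = e y * charfun \<mu> y" for y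
        using cf by (simp add: charfun_def[of \<nu>])
      then have "equivalent \<mu> \<nu>" using e by (simp add: equivalent_def abs_mult)
      then obtain k where "\<nu> = shift k \<mu>" using \<mu> by (auto simp: TEC_def)
      then have "e y * charfun \<mu> y = character k y * charfun \<mu> y" for y
        using c\<nu> charfun_shift by metis
      then show "sim \<mu> e (\<lambda>_. 1)" by (intro simI[of _ _ k]) (metis mult_cancel_right mult.right_neutral)
    qed
  qed
next
  assume *: "\<forall>e. e 0 = 1 \<and> (\<forall>y. \<bar>e y\<bar> = 1) \<longrightarrow> admissible \<mu> e"
  show "\<mu> \<in> TEC" unfolding TEC_def
  proof (intro CollectI allI impI)
    fix \<nu> assume eq: "equivalent \<mu> \<nu>"
    \<comment> \<open>Where \<open>charfun \<mu>\<close> vanishes, so does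
      \<open>charfun \<nu>\<close>; the default \<open>1\<close> keeps \<open>e\<close> a sign
      pattern.\<close>
    define e where "e y = (if charfun \<mu> y = 0 then 1 else charfun \<nu> y / charfun \<mu> y)" for y
    have ce: "charfun \<nu> y = e y * charfun \<mu> y" for y
      using eq by (auto simp: equivalent_def e_def) (metis abs_eq_0)
    have "twist \<mu> e x = pmf \<nu> x" for x
      using twist_one[of \<nu> x] by (simp add: twist_def ce)
    moreover have "e 0 = 1" "\<bar>e y\<bar> = 1" for y
      using eq by (auto simp: equivalent_def e_def abs_divide)
    ultimately have "sim \<mu> e (\<lambda>_. 1)"
      using * by (simp add: admissible_def feasible_def)
    then obtain k where "\<And>y. charfun \<mu> y \<noteq> 0 \<Longrightarrow> e y = character k y"
      by (auto simp: sim_def)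
    then have "charfun \<nu> = charfun (shift k \<mu>)"
      by (intro ext) (metis ce charfun_shift mult_zero_right)
    then show "\<exists>x. \<nu> = shift x \<mu>" using charfun_inject by blast
  qed
qed

section \<open>Normal forms of sign patterns modulo characters\<close>

definition flip :: "z23 \<Rightarrow> z23 \<Rightarrow> real" where
  "flip s y = (if y = s then - 1 else 1)"

definition coflip :: "z23 \<Rightarrow> z23 \<Rightarrow> real" where
  "coflip s y = (if y = 0 \<or> y = s then 1 else - 1)"

text \<open>Take the character that is \<open>1\<close> on the line through \<open>y\<close> and
  \<open>s\<close> and \<open>- 1\<close> off it. Multiplied by the two flips it keeps the sign
  \<open>1\<close> only at \<open>0\<close> and at the third point \<open>y + s\<close>.\<close>

lemma flip_mult_flip:
  assumes "y \<noteq> 0" "s \<noteq> 0" "y \<noteq> s"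
  shows "\<exists>k. \<forall>u. flip y u * flip s u = character k u * coflip (y + s) u"
proof -
  obtain k where "\<And>r. character r k = (if r \<in> {0, y, s, y + s} then 1 else - 1)"
    using ex_character_span[of y s] assms by metis
  then have "flip y u * flip s u = character k u * coflip (y + s) u" for u
    using assms by (auto simp: flip_def coflip_def character_commute[of k])
  then show ?thesis by blast
qed

lemma flip_mult_coflip:
  assumes "y \<noteq> 0" "s \<noteq> 0" "y \<noteq> s"
  shows "\<exists>k. \<forall>u. flip y u * coflip s u = character k u * flip (y + s) u"
proof -
  obtain k where k: "\<And>u. flip y u * flip (y + s) u = character k u * coflip s u"
    using flip_mult_flip[of y "y + s"] assms by auto
  have "flip y u * coflip s u = character k u * flip (y + s) u" for u
  proof -
    have "flip y u * (flip y u * flip (y + s) u) = flip (y + s) u" by (simp add: flip_def)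
    then show ?thesis unfolding k by (metis character_sq mult.left_commute mult.left_neutral mult.assoc)
  qed
  then show ?thesis by blast
qed

lemma flip_mult_coflip_0: "flip y u * coflip 0 u = coflip y u" if "y \<noteq> 0"
  using that by (simp add: flip_def coflip_def)

lemma flip_mult_coflip_self: "flip y u * coflip y u = coflip 0 u" if "y \<noteq> 0"
  using that by (simp add: flip_def coflip_def)

text \<open>Induction on the set of sign changes: a new point contributes a factor
  \<open>flip y\<close>, and up to characters the list of normal forms is closed under such
  factors.\<close>

lemma sign_class_set:
  assumes "0 \<notin> A"
  shows "\<exists>k e. (e = (\<lambda>_. 1) \<or> (\<exists>s. s \<noteq> 0 \<and> e = flip s) \<or> (\<exists>s. e = coflip s))
    \<and> (\<forall>u. (if u \<in> A then - 1 else 1) = character k u * e u)"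
proof -
  have "finite A" by (rule finite)
  then show ?thesis using assms
  proof (induction A rule: finite_induct)
    case empty
    show ?case by (intro exI[of _ 0] exI[of _ "\<lambda>_. 1"]) simp
  next
    case (insert y A)
    have "0 \<notin> A" using insert.prems by blast
    then obtain k e where e: "e = (\<lambda>_. 1) \<or> (\<exists>s. s \<noteq> 0 \<and> e = flip s) \<or> (\<exists>s. e = coflip s)"
      and k: "\<And>u. (if u \<in> A then - 1 else 1) = character k u * e u"
      using insert.IH by blast
    have y: "y \<noteq> 0" using insert.prems by blast
    have split: "(if u \<in> insert y A then - 1 else 1) = character k u * (flip y u * e u)" for u
      using k[of u] insert.hyps by (auto simp: flip_def)
    have "\<exists>k' e'. (e' = (\<lambda>_. 1) \<or> (\<exists>s. s \<noteq> 0 \<and> e' = flip s) \<or> (\<exists>s. e' = coflip s))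
        \<and> (\<forall>u. flip y u * e u = character k' u * e' u)"
      using e
    proof (elim disjE exE conjE)
      assume "e = (\<lambda>_. 1)"
      then show ?thesis using y by (intro exI[of _ 0] exI[of _ "flip y"]) auto
    next
      fix s assume s: "s \<noteq> 0" "e = flip s"
      show ?thesis
      proof (cases "s = y")
        case True
        then show ?thesis using s by (intro exI[of _ 0] exI[of _ "\<lambda>_. 1"]) (auto simp: flip_def)
      next
        case False
        then show ?thesis using flip_mult_flip[of y s] s y by blast
      qed
    next
      fix s assume s: "e = coflip s"
      consider "s = 0" | "s = y" | "s \<noteq> 0" "s \<noteq> y" by blast
      then show ?thesis
      proof cases
        case 1
        then show ?thesis using s y flip_mult_coflip_0 by (intro exI[of _ 0] exI[of _ "coflip y"]) auto
      next
        case 2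
        then show ?thesis using s y flip_mult_coflip_self by (intro exI[of _ 0] exI[of _ "coflip 0"]) auto
      next
        case 3
        then have "y + s \<noteq> 0" by simp
        with 3 show ?thesis using flip_mult_coflip[of y s] s y by blast
      qed
    qed
    then obtain k' e' where "e' = (\<lambda>_. 1) \<or> (\<exists>s. s \<noteq> 0 \<and> e' = flip s) \<or> (\<exists>s. e' = coflip s)"
      "\<And>u. flip y u * e u = character k' u * e' u" by blast
    then show ?case unfolding split
      by (intro exI[of _ "k + k'"] exI[of _ e']) (simp add: character_add_left)
  qed
qed

lemma TEC_iff:
  "\<mu> \<in> TEC \<longleftrightarrow> admissible \<mu> (coflip 0) \<and>
    (\<forall>s. s \<noteq> 0 \<longrightarrow> admissible \<mu> (flip s) \<and> admissible \<mu> (coflip s))"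
proof
  assume "\<mu> \<in> TEC"
  then have *: "admissible \<mu> e" if "e 0 = 1" "\<And>y. \<bar>e y\<bar> = 1" for e
    using that by (simp add: TEC_iff_signs)
  show "admissible \<mu> (coflip 0) \<and> (\<forall>s. s \<noteq> 0 \<longrightarrow> admissible \<mu> (flip s) \<and> admissible \<mu> (coflip s))"
    by (intro conjI allI impI *) (auto simp: flip_def coflip_def)
next
  assume R: "admissible \<mu> (coflip 0) \<and> (\<forall>s. s \<noteq> 0 \<longrightarrow> admissible \<mu> (flip s) \<and> admissible \<mu> (coflip s))"
  have one: "admissible \<mu> (\<lambda>_. 1)" by (simp add: admissible_def sim_refl)
  show "\<mu> \<in> TEC" unfolding TEC_iff_signs
  proof (intro allI impI)
    fix e :: "z23 \<Rightarrow> real" assume e: "e 0 = 1 \<and> (\<forall>y. \<bar>e y\<bar> = 1)"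
    have eA: "e u = (if u \<in> {y. e y = - 1} then - 1 else 1)" for u
      using e by (auto simp: abs_if split: if_splits)
    have "0 \<notin> {y. e y = - 1}" using e by simp
    from sign_class_set[OF this] obtain k e' where
      e': "e' = (\<lambda>_. 1) \<or> (\<exists>s. s \<noteq> 0 \<and> e' = flip s) \<or> (\<exists>s. e' = coflip s)"
      and "\<And>u. (if u \<in> {y. e y = - 1} then - 1 else 1) = character k u * e' u"
      by blast
    with eA have "\<And>u. e u = character k u * e' u" by simp
    then have "sim \<mu> e e'" by (intro simI)
    moreover have "admissible \<mu> e'" using e' R one by metis
    ultimately show "admissible \<mu> e" by (rule sim_admissible)
  qed
qed

text \<open>A change of sign at a zero \<open>y\<close> is free, so \<open>flip r\<close> may be
  replaced by a product of two flips, which is a \<open>coflip\<close> up to a character.\<close>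

lemma sim_flip_coflip:
  assumes "charfun \<mu> y = 0" "y \<noteq> r" "r \<noteq> 0"
  shows "sim \<mu> (flip r) (coflip (r + y))"
proof -
  have "y \<noteq> 0" using assms(1) by auto
  then obtain k where k: "\<And>u. flip r u * flip y u = character k u * coflip (r + y) u"
    using flip_mult_flip[of r y] assms by auto
  have "flip r u = flip r u * flip y u" if "charfun \<mu> u \<noteq> 0" for u
    using that assms(1) by (auto simp: flip_def)
  then show ?thesis using k by (intro simI[of _ _ k]) simp
qed

lemma sim_flip_one: "charfun \<mu> r = 0 \<Longrightarrow> sim \<mu> (flip r) (\<lambda>_. 1)"
  by (rule simI[of _ _ 0]) (auto simp: flip_def)

section \<open>Explicit twisted masses of the normal forms\<close>

lemma twist_flip: "twist \<mu> (flip s) x = pmf \<mu> x - charfun \<mu> s * character x s / 4"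
proof -
  have "(\<Sum>y\<in>UNIV. flip s y * charfun \<mu> y * character x y)
      = (\<Sum>y\<in>UNIV. 1 * charfun \<mu> y * character x y
          - (if y = s then 2 * charfun \<mu> y * character x y else 0))"
    by (rule sum.cong) (auto simp: flip_def)
  also have "\<dots> = 8 * twist \<mu> (\<lambda>_. 1) x - 2 * charfun \<mu> s * character x s"
    unfolding sum_subtractf by (simp add: twist_def)
  finally show ?thesis
    unfolding twist_one by (simp add: twist_def[of \<mu> "flip s"])
qed

text \<open>The pattern is the negative of the trivial one except at \<open>0\<close>, where
  restoring the value one contributes 2 / 8 at every point.\<close>

lemma twist_coflip_0: "twist \<mu> (coflip 0) x = 1 / 4 - pmf \<mu> x"
proof -
  have "(\<Sum>y\<in>UNIV. coflip 0 y * charfun \<mu> y * character x y)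
      = (\<Sum>y\<in>UNIV. (if y = 0 then 2 * charfun \<mu> y * character x y else 0)
          - 1 * charfun \<mu> y * character x y)"
    by (rule sum.cong) (auto simp: coflip_def)
  also have "\<dots> = 2 - 8 * twist \<mu> (\<lambda>_. 1) x"
    unfolding sum_subtractf by (simp add: twist_def)
  finally show ?thesis
    unfolding twist_one by (simp add: twist_def[of \<mu> "coflip 0"])
qed

lemma twist_coflip:
  assumes "s \<noteq> 0"
  shows "twist \<mu> (coflip s) x = 1 / 4 - pmf \<mu> x + charfun \<mu> s * character x s / 4"
proof -
  have "(\<Sum>y\<in>UNIV. coflip s y * charfun \<mu> y * character x y)
      = (\<Sum>y\<in>UNIV. coflip 0 y * charfun \<mu> y * character x y
          + (if y = s then 2 * charfun \<mu> y * character x y else 0))"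
    by (rule sum.cong) (use assms in \<open>auto simp: coflip_def\<close>)
  also have "\<dots> = 8 * twist \<mu> (coflip 0) x + 2 * charfun \<mu> s * character x s"
    unfolding sum.distrib by (simp add: twist_def)
  finally show ?thesis
    unfolding twist_coflip_0 by (simp add: twist_def[of \<mu> "coflip s"])
qed

subsection \<open>The sets of measures in terms of sign changes\<close>

lemma prob_eq_sum: "measure_pmf.prob \<mu> A = (\<Sum>x\<in>A. pmf \<mu> x)" for \<mu> :: "z23 pmf"
  by (rule measure_measure_pmf_finite) simp

text \<open>The indicator of \<open>ker s\<close> is half the sum of the trivial character and the
  character \<open>s\<close>.\<close>

lemma prob_ker: "measure_pmf.prob \<mu> (ker s) = (1 + charfun \<mu> s) / 2"
proof -
  have "(\<Sum>x\<in>ker s. pmf \<mu> x) = (\<Sum>x\<in>UNIV. if x \<in> ker s then pmf \<mu> x else 0)"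
    by (simp add: sum.inter_restrict[symmetric])
  also have "\<dots> = (\<Sum>x\<in>UNIV. (pmf \<mu> x + pmf \<mu> x * character x s) / 2)"
    by (rule sum.cong) (use character_cases in \<open>auto simp: mem_ker\<close>)
  also have "\<dots> = (1 + charfun \<mu> s) / 2"
    unfolding sum_divide_distrib[symmetric] sum.distrib by (simp add: sum_pmf_z23 charfun_def)
  finally show ?thesis by (simp add: prob_eq_sum)
qed

lemma prob_Compl_ker: "measure_pmf.prob \<mu> (- ker s) = (1 - charfun \<mu> s) / 2"
  using measure_pmf.prob_compl[of "ker s" \<mu>] by (simp add: prob_ker Compl_eq_Diff_UNIV field_simps)

lemma u_max_image: "u_max \<mu> E = Max (pmf \<mu> ` E)"
  by (simp add: u_max_def setcompr_eq_image)

lemma U_set_iff: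
  assumes "E \<noteq> {}"
  shows "\<mu> \<in> U_set E \<longleftrightarrow> (\<exists>x\<in>E. measure_pmf.prob \<mu> E < 2 * pmf \<mu> x)"
proof -
  have "measure_pmf.prob \<mu> E < 2 * u_max \<mu> E \<longleftrightarrow> measure_pmf.prob \<mu> E / 2 < Max (pmf \<mu> ` E)"
    unfolding u_max_image by auto
  also have "\<dots> \<longleftrightarrow> (\<exists>x\<in>E. measure_pmf.prob \<mu> E / 2 < pmf \<mu> x)"
    using assms by (subst Max_gr_iff) auto
  finally show ?thesis by (simp add: U_set_def mult.commute pos_divide_less_eq)
qed

lemma V_set_iff:
  assumes "E \<noteq> {}"
  shows "\<mu> \<in> V_set E \<longleftrightarrow> (\<exists>x\<in>E. 1 / 2 + 2 * pmf \<mu> x < measure_pmf.prob \<mu> E)"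
proof -
  have "1 / 2 + 2 * v_min \<mu> E < measure_pmf.prob \<mu> E
      \<longleftrightarrow> Min (pmf \<mu> ` E) < (measure_pmf.prob \<mu> E - 1 / 2) / 2"
    by (auto simp: v_min_def setcompr_eq_image)
  also have "\<dots> \<longleftrightarrow> (\<exists>x\<in>E. pmf \<mu> x < (measure_pmf.prob \<mu> E - 1 / 2) / 2)"
    using assms by (subst Min_less_iff) auto
  finally show ?thesis by (auto simp: V_set_def field_simps)
qed

lemma ker_nonempty: "ker s \<noteq> {}"
  using mem_ker[of 0 s] by auto

lemma Compl_ker_nonempty: "s \<noteq> 0 \<Longrightarrow> - ker s \<noteq> {}"
  using ex_character_neg[of s] by (metis ComplI empty_iff not_mem_ker)

text \<open>The twisted mass at \<open>x\<close> equals half the mass of the coset of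
  \<open>ker s\<close> containing \<open>x\<close>, minus the mass of \<open>x\<close>.\<close>

lemma feasible_coflip_iff:
  assumes "s \<noteq> 0"
  shows "feasible \<mu> (coflip s) \<longleftrightarrow> \<not> (\<mu> \<in> U_set (ker s) \<or> \<mu> \<in> U_set (- ker s))"
proof -
  have "twist \<mu> (coflip s) x < 0 \<longleftrightarrow>
      (if x \<in> ker s then measure_pmf.prob \<mu> (ker s) < 2 * pmf \<mu> x
       else measure_pmf.prob \<mu> (- ker s) < 2 * pmf \<mu> x)" for x
    using character_cases[of x s]
    by (auto simp: twist_coflip[OF assms] prob_ker prob_Compl_ker mem_ker field_simps)
  then show ?thesis
    unfolding feasible_def not_less[symmetric] U_set_iff[OF ker_nonempty] U_set_iff[OF Compl_ker_nonempty[OF assms]]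
    by (metis ComplD ComplI)
qed

text \<open>The twisted mass at \<open>x\<close> equals the mass of \<open>x\<close> minus half of
  the excess over 1 / 2 of the mass of its coset.\<close>

lemma feasible_flip_iff:
  assumes "s \<noteq> 0"
  shows "feasible \<mu> (flip s) \<longleftrightarrow> \<not> (\<mu> \<in> V_set (ker s) \<or> \<mu> \<in> V_set (- ker s))"
proof -
  have "twist \<mu> (flip s) x < 0 \<longleftrightarrow>
      (if x \<in> ker s then 1 / 2 + 2 * pmf \<mu> x < measure_pmf.prob \<mu> (ker s)
       else 1 / 2 + 2 * pmf \<mu> x < measure_pmf.prob \<mu> (- ker s))" for x
    using character_cases[of x s]
    by (auto simp: twist_flip prob_ker prob_Compl_ker mem_ker field_simps)
  then show ?thesis
    unfolding feasible_def not_less[symmetric] V_set_iff[OF ker_nonempty] V_set_iff[OF Compl_ker_nonempty[OF assms]]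
    by (metis ComplD ComplI)
qed

lemma subgrp_ker: "subgrp (ker s)"
  by (simp add: subgrp_def mem_ker character_add_left)

subsection \<open>Subgroups and projections\<close>

lemma four_set_eq:
  fixes K :: "z23 set"
  assumes "card K = 4" "0 \<in> K" "\<And>x y. x \<in> K \<Longrightarrow> y \<in> K \<Longrightarrow> x + y \<in> K"
    and "a \<in> K" "b \<in> K" "a \<noteq> 0" "b \<noteq> 0" "a \<noteq> b"
  shows "K = {0, a, b, a + b}"
proof -
  have "card {0, a, b, a + b} = 4" using assms by auto
  moreover have "{0, a, b, a + b} \<subseteq> K" using assms by auto
  ultimately show ?thesis using card_subset_eq[of K "{0, a, b, a + b}"] assms(1) by simp
qed

lemma ker_eq_span:
  assumes "s \<noteq> 0" "a \<in> ker s" "b \<in> ker s" "a \<noteq> 0" "b \<noteq> 0" "a \<noteq> b"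
  shows "ker s = {0, a, b, a + b}"
  using assms by (intro four_set_eq) (auto simp: card_ker mem_ker character_add_left)

lemma four_set_span:
  fixes K :: "z23 set"
  assumes "card K = 4" "0 \<in> K" "\<And>x y. x \<in> K \<Longrightarrow> y \<in> K \<Longrightarrow> x + y \<in> K"
  obtains a b where "a \<in> K" "b \<in> K" "a \<noteq> 0" "b \<noteq> 0" "a \<noteq> b" "K = {0, a, b, a + b}"
proof -
  have "\<not> K \<subseteq> {0}" using assms(1) card_mono[of "{0 :: z23}" K] by auto
  then obtain a where a: "a \<in> K" "a \<noteq> 0" by blast
  have "\<not> K \<subseteq> {0, a}" using assms(1) card_mono[of "{0, a}" K] a by auto
  then obtain b where b: "b \<in> K" "b \<noteq> 0" "b \<noteq> a" by blast
  show thesis using that[OF a(1) b(1) a(2) b(2)] four_set_eq[OF assms a(1) b(1) a(2) b(2)] b by blast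
qed

lemma subgroups1_eq: "\<AA>\<^sub>1 = {{0, g} | g. g \<noteq> 0}"
proof (intro equalityI subsetI)
  fix H assume "H \<in> \<AA>\<^sub>1"
  then obtain \<phi> :: "z23 \<Rightarrow> bit" where H: "0 \<in> H" "bij_betw \<phi> H UNIV"
    by (auto simp: subgroups1_def subgrp_def grp_isomorphic_def)
  then have "card H = 2" using bij_betw_same_card by force
  then obtain a b where "H = {a, b}" "a \<noteq> b" unfolding card_2_iff by blast
  with H(1) have "H = {0, a + b}" "a + b \<noteq> 0" by auto
  then show "H \<in> {{0, g} | g. g \<noteq> 0}" by blast
next
  fix H :: "z23 set" assume "H \<in> {{0, g} | g. g \<noteq> 0}"
  then obtain g where g: "H = {0, g}" "g \<noteq> 0" by blast
  have "subgrp H" by (auto simp: g subgrp_def)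
  moreover have "bij_betw (\<lambda>x. if x = 0 then 0 else 1 :: bit) H UNIV"
    using g by (auto simp: bij_betw_def inj_on_def image_iff all_bit set_eq_iff)
  then have "grp_isomorphic H (UNIV :: bit set)"
    unfolding grp_isomorphic_def
    by (intro exI[of _ "\<lambda>x. if x = 0 then 0 else 1 :: bit"]) (use g in auto)
  ultimately show "H \<in> \<AA>\<^sub>1" by (simp add: subgroups1_def)
qed

text \<open>A subgroup of order four is spanned by two elements and hence is the kernel of their
  normal character. Conversely, coordinates with respect to two spanning elements of a kernel give
  the isomorphism.\<close>

lemma subgroups2_eq: "\<AA>\<^sub>2 = {ker s | s. s \<noteq> 0}"
proof (intro equalityI subsetI)
  fix K assume K: "K \<in> \<AA>\<^sub>2"
  then obtain \<phi> :: "z23 \<Rightarrow> bit \<times> bit" where "bij_betw \<phi> K UNIV"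
    by (auto simp: subgroups2_def grp_isomorphic_def)
  then have "card K = 4" using bij_betw_same_card by force
  moreover have "0 \<in> K" "\<And>x y. x \<in> K \<Longrightarrow> y \<in> K \<Longrightarrow> x + y \<in> K"
    using K unfolding subgroups2_def subgrp_def by blast+
  ultimately obtain a b where ab: "a \<noteq> 0" "b \<noteq> 0" "a \<noteq> b" "K = {0, a, b, a + b}"
    using four_set_span by metis
  obtain k where k0: "k \<noteq> 0" and k: "\<And>r. character r k = (if r \<in> {0, a, b, a + b} then 1 else - 1)"
    using ex_character_span[OF ab(1-3)] by blast
  then have eq: "ker k = K" by (auto simp: ker_def ab(4) split: if_splits)
  with eq k0 show "K \<in> {ker s | s. s \<noteq> 0}" by blast
next
  fix K :: "z23 set" assume "K \<in> {ker s | s. s \<noteq> 0}"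
  then obtain s where s: "K = ker s" "s \<noteq> 0" by blast
  have "card K = 4" using s card_ker by simp
  moreover have "0 \<in> K" "\<And>x y. x \<in> K \<Longrightarrow> y \<in> K \<Longrightarrow> x + y \<in> K"
    using s by (auto simp: mem_ker character_add_left)
  ultimately obtain a b where ab: "a \<noteq> 0" "b \<noteq> 0" "a \<noteq> b" "K = {0, a, b, a + b}"
    using four_set_span by metis
  define \<phi> where "\<phi> x = (if x = a \<or> x = a + b then 1 else 0 :: bit, if x = b \<or> x = a + b then 1 else 0 :: bit)" for x
  have \<phi>: "\<phi> 0 = 0" "\<phi> a = (1, 0)" "\<phi> b = (0, 1)" "\<phi> (a + b) = (1, 1)"
    using ab by (auto simp: \<phi>_def simp flip: zero_prod_def)
  have "\<phi> ` K = {(0, 0), (1, 0), (0, 1), (1, 1)}" by (simp add: ab(4) \<phi> flip: zero_prod_def)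
  also have "\<dots> = UNIV"
  proof (rule UNIV_eq_I[symmetric])
    fix x :: "bit \<times> bit"
    show "x \<in> {(0, 0), (1, 0), (0, 1), (1, 1)}"
      by (cases x; cases "fst x"; cases "snd x") simp_all
  qed
  finally have "\<phi> ` K = UNIV" .
  moreover have "inj_on \<phi> K"
    by (rule eq_card_imp_inj_on) (simp_all add: \<open>\<phi> ` K = UNIV\<close> \<open>card K = 4\<close>)
  moreover have "\<forall>x\<in>K. \<forall>y\<in>K. \<phi> (x + y) = \<phi> x + \<phi> y"
    using \<phi> by (auto simp: ab(4) add.commute[of b a] add.assoc add.left_commute[of b a] simp flip: zero_prod_def)
  ultimately have "grp_isomorphic K (UNIV :: (bit \<times> bit) set)"
    unfolding grp_isomorphic_def bij_betw_def by blast
  then show "K \<in> \<AA>\<^sub>2" using s subgrp_ker by (simp add: subgroups2_def)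
qed

lemma ball_subgroups2: "(\<forall>K\<in>\<AA>\<^sub>2. P K) \<longleftrightarrow> (\<forall>s. s \<noteq> 0 \<longrightarrow> P (ker s))"
  unfolding subgroups2_eq by blast

lemma bex_subgroups2: "(\<exists>K\<in>\<AA>\<^sub>2. P K) \<longleftrightarrow> (\<exists>s. s \<noteq> 0 \<and> P (ker s))"
  unfolding subgroups2_eq by blast

lemma bex_subgroups1: "(\<exists>H\<in>\<AA>\<^sub>1. P H) \<longleftrightarrow> (\<exists>g. g \<noteq> 0 \<and> P {0, g})"
  unfolding subgroups1_eq by blast

lemma subset_ker_iff: "{0, g} \<subseteq> ker s \<longleftrightarrow> character g s = 1"
  by (simp add: mem_ker)

lemma ker_inject: "ker s = ker r \<longleftrightarrow> s = r"
proof
  assume eq: "ker s = ker r"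
  have "character x (s + r) = 1" for x
    using character_cases[of x s] character_cases[of x r] eq
    unfolding set_eq_iff mem_ker character_add_right by force
  then show "s = r" using ex_character_neg[of "s + r"] by (metis add_eq_0_z23 one_neq_neg_one)
qed simp

section \<open>Decompositions into a line and a plane, and their projections\<close>

lemma direct_sum_iff:
  assumes "g \<noteq> 0"
  shows "direct_sum {0, g} (ker s) \<longleftrightarrow> character g s = - 1"
proof
  assume "direct_sum {0, g} (ker s)"
  then have "g \<notin> ker s" using assms by (auto simp: direct_sum_def)
  then show "character g s = - 1" by (simp add: not_mem_ker)
next
  assume g: "character g s = - 1"
  have "z \<in> {x1 + x2 | x1 x2. x1 \<in> {0, g} \<and> x2 \<in> ker s}" for z
  proof (cases "z \<in> ker s")
    case True
    have "z = 0 + z" by simp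
    with True show ?thesis by blast
  next
    case False
    then have "g + z \<in> ker s" using g by (simp add: mem_ker character_add_left)
    moreover have "z = g + (g + z)" by simp
    ultimately show ?thesis by blast
  qed
  then show "direct_sum {0, g} (ker s)"
    using g subgrp_ker by (auto simp: direct_sum_def subgrp_def mem_ker)
qed

lemma proj_on_ker:
  assumes "character g s = - 1"
  shows "proj_on (ker s) {0, g} z = (if z \<in> ker s then z else z + g)"
  unfolding proj_on_def
proof (rule the_equality)
  show "(if z \<in> ker s then z else z + g) \<in> ker s \<and> (\<exists>y\<in>{0, g}. z = (if z \<in> ker s then z else z + g) + y)"
    using assms by (auto simp: mem_ker character_add_left add.assoc)
  fix x assume "x \<in> ker s \<and> (\<exists>y\<in>{0, g}. z = x + y)"
  then show "x = (if z \<in> ker s then z else z + g)"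
    using assms by (auto simp: mem_ker character_add_left add.assoc)
qed

lemma proj_on_line:
  assumes "character g s = - 1"
  shows "proj_on {0, g} (ker s) z = (if z \<in> ker s then 0 else g)"
  unfolding proj_on_def
proof (rule the_equality)
  have "z = g + (g + z)" by simp
  then show "(if z \<in> ker s then 0 else g) \<in> {0, g} \<and> (\<exists>y\<in>ker s. z = (if z \<in> ker s then 0 else g) + y)"
    using assms by (auto simp: mem_ker character_add_left intro!: bexI[of _ "g + z"])
  fix x assume "x \<in> {0, g} \<and> (\<exists>y\<in>ker s. z = x + y)"
  then show "x = (if z \<in> ker s then 0 else g)"
    using assms by (auto simp: mem_ker character_add_left)
qed

text \<open>The fibres of the projection are the pairs \<open>{x, x + g}\<close>, and the Haar
  measure gives each of them mass 1 / 4.\<close>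

lemma cond_I1_iff:
  assumes "character g s = - 1"
  shows "cond_I1 \<mu> {0, g} (ker s) \<longleftrightarrow> (\<forall>x. pmf \<mu> x + pmf \<mu> (x + g) = 1 / 4)"
proof -
  have s: "s \<noteq> 0" and g: "g \<noteq> 0" using assms by auto
  have in_ker: "x + g \<in> ker s \<longleftrightarrow> x \<notin> ker s" for x
    using assms character_cases[of x s] by (auto simp: mem_ker character_add_left)
  have vimage: "proj_on (ker s) {0, g} -` {x} = (if x \<in> ker s then {x, x + g} else {})" for x
  proof (rule set_eqI)
    fix z
    show "z \<in> proj_on (ker s) {0, g} -` {x} \<longleftrightarrow> z \<in> (if x \<in> ker s then {x, x + g} else {})"
      using in_ker[of x] in_ker[of z] by (auto simp: proj_on_ker[OF assms] add_eq_iff_z23)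
  qed
  have pp: "pmf (proj_measure (ker s) {0, g} \<mu>) x = (if x \<in> ker s then pmf \<mu> x + pmf \<mu> (x + g) else 0)" for x
    using g by (simp add: proj_measure_def pmf_map vimage prob_eq_sum)
  have "cond_I1 \<mu> {0, g} (ker s) \<longleftrightarrow> (\<forall>x\<in>ker s. pmf \<mu> x + pmf \<mu> (x + g) = 1 / 4)"
    using ker_nonempty[of s] card_ker[OF s]
    by (auto simp: cond_I1_def haar_def pmf_eq_iff pp indicator_def)
  also have "\<dots> \<longleftrightarrow> (\<forall>x. pmf \<mu> x + pmf \<mu> (x + g) = 1 / 4)"
  proof (intro iffI allI ballI)
    fix x assume *: "\<forall>x\<in>ker s. pmf \<mu> x + pmf \<mu> (x + g) = 1 / 4"
    show "pmf \<mu> x + pmf \<mu> (x + g) = 1 / 4"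
    proof (cases "x \<in> ker s")
      case False
      with * in_ker have "pmf \<mu> (x + g) + pmf \<mu> (x + g + g) = 1 / 4" by blast
      then show ?thesis by (simp add: add.assoc)
    qed (use * in blast)
  qed blast
  finally show ?thesis .
qed

lemma haar_line_iff:
  assumes "character g s = - 1"
  shows "proj_measure {0, g} (ker s) \<mu> = haar {0, g} \<longleftrightarrow> charfun \<mu> s = 0"
proof -
  have g: "g \<noteq> 0" using assms by auto
  have "proj_on {0, g} (ker s) -` {x} = (if x = 0 then ker s else if x = g then - ker s else {})" for x
  proof (rule set_eqI)
    fix z
    show "z \<in> proj_on {0, g} (ker s) -` {x} \<longleftrightarrow> z \<in> (if x = 0 then ker s else if x = g then - ker s else {})"
      using g by (auto simp: proj_on_line[OF assms])
  qed
  then have pp: "pmf (proj_measure {0, g} (ker s) \<mu>) x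
      = (if x = 0 then (1 + charfun \<mu> s) / 2 else if x = g then (1 - charfun \<mu> s) / 2 else 0)" for x
    by (simp add: proj_measure_def pmf_map prob_ker prob_Compl_ker)
  have "proj_measure {0, g} (ker s) \<mu> = haar {0, g} \<longleftrightarrow>
      (\<forall>x. (if x = 0 then (1 + charfun \<mu> s) / 2 else if x = g then (1 - charfun \<mu> s) / 2 else 0)
        = indicator {0, g} x / 2)"
    using g by (simp add: haar_def pmf_eq_iff pp)
  also have "\<dots> \<longleftrightarrow> charfun \<mu> s = 0"
    using g by (auto simp: indicator_def dest: spec[of _ 0])
  finally show ?thesis .
qed

text \<open>With \<open>c = 1\<close> the coefficients at \<open>y\<close> with
  \<open>character k y = - 1\<close> cancel, with \<open>c = - 1\<close> those where this value is
  \<open>1\<close>.\<close>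

lemma pmf_add_translate:
  "pmf \<mu> x + c * pmf \<mu> (x + k)
    = (\<Sum>y\<in>UNIV. charfun \<mu> y * (1 + c * character k y) * character x y) / 8"
proof -
  have "pmf \<mu> x + c * pmf \<mu> (x + k) = twist \<mu> (\<lambda>_. 1) x + c * twist \<mu> (\<lambda>_. 1) (x + k)"
    by (simp only: twist_one)
  also have "\<dots> = (\<Sum>y\<in>UNIV. charfun \<mu> y * character x y + c * (charfun \<mu> y * character (x + k) y)) / 8"
    by (simp add: twist_def sum.distrib sum_distrib_left add_divide_distrib)
  also have "\<dots> = (\<Sum>y\<in>UNIV. charfun \<mu> y * (1 + c * character k y) * character x y) / 8"
    by (simp add: character_add_left algebra_simps)
  finally show ?thesis .
qed

subsection \<open>The conditions in terms of zeros of the characteristic function\<close>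

text \<open>The sum of the mass function and its translate by \<open>g\<close> has Fourier
  coefficients \<open>(1 + character g y) * charfun \<mu> y\<close>, and it is constant iff those at
  nonzero \<open>y\<close> vanish. For \<open>g \<noteq> 0\<close> the points \<open>y\<close>
  concerned form a line of the Fano plane.\<close>

lemma sum_quarter_iff:
  "(\<forall>x. pmf \<mu> x + pmf \<mu> (x + g) = 1 / 4)
    \<longleftrightarrow> (\<forall>y. y \<noteq> 0 \<and> character g y = 1 \<longrightarrow> charfun \<mu> y = 0)"
proof (intro iffI allI impI)
  fix y assume *: "\<forall>x. pmf \<mu> x + pmf \<mu> (x + g) = 1 / 4" and y: "y \<noteq> 0 \<and> character g y = 1"
  have "2 * charfun \<mu> y = (\<Sum>x\<in>UNIV. pmf \<mu> x * character x y) + (\<Sum>x\<in>UNIV. pmf \<mu> (x + g) * character x y)"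
    using y by (simp add: sum_translate charfun_def)
  also have "\<dots> = (\<Sum>x\<in>UNIV. (pmf \<mu> x + pmf \<mu> (x + g)) * character x y)"
    by (simp only: sum.distrib distrib_right)
  also have "\<dots> = (\<Sum>x\<in>UNIV. 1 / 4 * character x y)"
    unfolding spec[OF *] ..
  also have "\<dots> = 0"
    unfolding sum_distrib_left[symmetric] using y by (simp add: sum_character)
  finally show "charfun \<mu> y = 0" by simp
next
  fix x assume *: "\<forall>y. y \<noteq> 0 \<and> character g y = 1 \<longrightarrow> charfun \<mu> y = 0"
  have "pmf \<mu> x + pmf \<mu> (x + g) = (\<Sum>y\<in>UNIV. charfun \<mu> y * (1 + 1 * character g y) * character x y) / 8"
    using pmf_add_translate[of \<mu> x 1 g] by simp
  also have "(\<Sum>y\<in>UNIV. charfun \<mu> y * (1 + 1 * character g y) * character x y) = (\<Sum>y\<in>(UNIV :: z23 set). if y = 0 then 2 else 0)"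
    by (rule sum.cong) (use * character_cases[of g] in \<open>force+\<close>)
  finally show "pmf \<mu> x + pmf \<mu> (x + g) = 1 / 4" by simp
qed

text \<open>Each equation in the definition compares \<open>d\<close> at two points of
  \<open>ker s\<close>, one of them \<open>0\<close>, so together they say that \<open>d\<close> is
  constant there. Since translation by \<open>g\<close> negates \<open>d\<close>, this makes it a
  multiple of the character \<open>s\<close>, that is, all its other Fourier coefficients
  vanish.\<close>

lemma W_set_iff:
  assumes gs: "character g s = - 1"
  shows "\<mu> \<in> W_set {0, g} (ker s) \<longleftrightarrow> (\<forall>y. y \<noteq> s \<and> character g y = - 1 \<longrightarrow> charfun \<mu> y = 0)"
proof -
  define d where "d x = pmf \<mu> x - pmf \<mu> (x + g)" for x
  have s: "s \<noteq> 0" and g: "g \<noteq> 0" using gs by auto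
  have "\<mu> \<in> W_set {0, g} (ker s) \<longleftrightarrow> (\<forall>x\<in>ker s. d x = d 0)"
  proof
    assume W: "\<mu> \<in> W_set {0, g} (ker s)"
    show "\<forall>x\<in>ker s. d x = d 0"
    proof
      fix x assume x: "x \<in> ker s"
      show "d x = d 0"
      proof (cases "x = 0")
        case False
        have xg: "x \<noteq> g" using x gs by (auto simp: mem_ker)
        \<comment> \<open>\<open>ker r\<close> is the subgroup \<open>L\<close> spanned by
          \<open>g\<close> and \<open>x\<close>; in the definition of \<open>W_set\<close>,
          \<open>x\<close> stands for \<open>s\<close> and \<open>g + x\<close> for
          \<open>t\<close>.\<close>
        obtain r where r0: "r \<noteq> 0" and r: "\<And>z. character z r = (if z \<in> {0, g, x, g + x} then 1 else - 1)"
          using ex_character_span[of g x] g False xg by metis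
        have "{0, g} = {0, g} \<and> g \<noteq> 0 \<and> ker r \<in> \<AA>\<^sub>2 \<and> {0, g} \<subseteq> ker r \<and> g + x \<in> ker r \<and>
            g + x \<in> - ker s \<and> g + x \<noteq> g \<and> x \<in> ker r \<and> x \<notin> {0, g, g + x}"
        proof (intro conjI)
          show "ker r \<in> \<AA>\<^sub>2" using r0 unfolding subgroups2_eq by blast
          show "g + x \<in> - ker s" using x gs by (simp add: mem_ker character_add_left)
        qed (use g False xg in \<open>simp_all add: mem_ker r\<close>)
        then have "measure_pmf.prob \<mu> {0, g + x} = measure_pmf.prob \<mu> {g, x}"
          by (rule W[unfolded W_set_def mem_Collect_eq, rule_format])
        then show ?thesis using xg g by (simp add: prob_eq_sum d_def add.commute)
      qed simp
    qed
  next
    assume d: "\<forall>x\<in>ker s. d x = d 0"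
    show "\<mu> \<in> W_set {0, g} (ker s)" unfolding W_set_def
    proof (intro CollectI allI impI)
      fix h L t z
      assume A: "{0, g} = {0, h} \<and> h \<noteq> 0 \<and> L \<in> \<AA>\<^sub>2 \<and> {0, g} \<subseteq> L \<and>
            t \<in> L \<and> t \<in> - ker s \<and> t \<noteq> h \<and> z \<in> L \<and> z \<notin> {0, h, t}"
      then have h: "h = g" by (auto simp: doubleton_eq_iff)
      have A': "L \<in> \<AA>\<^sub>2" "g \<in> L" "t \<in> L" "t \<notin> ker s" "t \<noteq> g" "z \<in> L" "z \<noteq> 0" "z \<noteq> g" "z \<noteq> t"
        using A unfolding h by blast+
      obtain r where r: "r \<noteq> 0" "L = ker r" using A'(1) unfolding subgroups2_eq by blast
      have t0: "t \<noteq> 0" using A'(4) by (metis character_zero(1) mem_ker)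
      have "L = {0, g, t, g + t}"
        unfolding r(2) by (rule ker_eq_span) (use A' r g t0 in auto)
      then have z: "z = g + t" using A' by blast
      then have "z \<in> ker s" using A'(4) gs by (simp add: mem_ker character_add_left)
      then have "d z = d 0" using d by blast
      then show "measure_pmf.prob \<mu> {0, t} = measure_pmf.prob \<mu> {h, z}"
        using A' h z g t0 by (auto simp: prob_eq_sum d_def add_ac)
    qed
  qed
  also have "\<dots> \<longleftrightarrow> (\<forall>y. y \<noteq> s \<and> character g y = - 1 \<longrightarrow> charfun \<mu> y = 0)"
  proof (intro iffI allI impI ballI)
    fix y assume d: "\<forall>x\<in>ker s. d x = d 0" and y: "y \<noteq> s \<and> character g y = - 1"
    have dx: "d x = d 0 * character x s" for x
    proof (cases "x \<in> ker s")
      case True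
      then have "d x = d 0" using d by blast
      with True show ?thesis by (simp add: mem_ker)
    next
      case False
      then have "x + g \<in> ker s" using gs by (simp add: mem_ker character_add_left)
      then have "d (x + g) = d 0" using d by blast
      with False show ?thesis by (simp add: mem_ker d_def add.assoc)
    qed
    have "2 * charfun \<mu> y = (\<Sum>x\<in>UNIV. pmf \<mu> x * character x y) - (\<Sum>x\<in>UNIV. pmf \<mu> (x + g) * character x y)"
      using y by (simp add: sum_translate charfun_def)
    also have "\<dots> = (\<Sum>x\<in>UNIV. d x * character x y)"
      by (simp only: sum_subtractf left_diff_distrib d_def)
    also have "\<dots> = (\<Sum>x\<in>UNIV. d 0 * character x (s + y))"
      by (intro sum.cong refl, subst dx) (simp add: character_add_right)
    also have "\<dots> = 0" using y by (auto simp: sum_character simp flip: sum_distrib_left)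
    finally show "charfun \<mu> y = 0" by simp
  next
    fix x assume *: "\<forall>y. y \<noteq> s \<and> character g y = - 1 \<longrightarrow> charfun \<mu> y = 0" and x: "x \<in> ker s"
    have "d z = charfun \<mu> s / 4" if "z \<in> ker s" for z
    proof -
      have "d z = (\<Sum>y\<in>UNIV. charfun \<mu> y * (1 + - 1 * character g y) * character z y) / 8"
        using pmf_add_translate[of \<mu> z "- 1" g] by (simp add: d_def)
      also have "(\<Sum>y\<in>UNIV. charfun \<mu> y * (1 + - 1 * character g y) * character z y)
          = (\<Sum>y\<in>UNIV. if y = s then 2 * charfun \<mu> y else 0)"
      proof (rule sum.cong)
        fix y
        show "charfun \<mu> y * (1 + - 1 * character g y) * character z y = (if y = s then 2 * charfun \<mu> y else 0)"
          using * that gs character_cases[of g y] by (auto simp: mem_ker)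
      qed simp
      finally show ?thesis by simp
    qed
    from this[of x] this[of 0] show "d x = d 0" using x by (simp add: mem_ker)
  qed
  finally show ?thesis .
qed

section \<open>Halvings of a plane and pairs of Fourier coefficients\<close>

lemma sum_ker_translate:
  "(\<Sum>x\<in>ker s. pmf \<mu> (g + x) * character x y)
    = (character g y * charfun \<mu> y + character g (y + s) * charfun \<mu> (y + s)) / 2"
proof -
  have "(\<Sum>x\<in>ker s. pmf \<mu> (g + x) * character x y)
      = (\<Sum>x\<in>UNIV. if x \<in> ker s then pmf \<mu> (g + x) * character x y else 0)"
    by (simp add: sum.inter_restrict[symmetric])
  also have "\<dots> = (\<Sum>x\<in>UNIV. (pmf \<mu> (x + g) * character x y + pmf \<mu> (x + g) * character x (y + s)) / 2)"
  proof (rule sum.cong)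
    fix x
    show "(if x \<in> ker s then pmf \<mu> (g + x) * character x y else 0)
        = (pmf \<mu> (x + g) * character x y + pmf \<mu> (x + g) * character x (y + s)) / 2"
      using character_cases[of x s] by (auto simp: mem_ker character_add_right add.commute)
  qed simp
  also have "\<dots> = (character g y * charfun \<mu> y + character g (y + s) * charfun \<mu> (y + s)) / 2"
    unfolding sum_divide_distrib[symmetric] sum.distrib sum_translate ..
  finally show ?thesis .
qed

text \<open>\<open>E\<close> is a coset of some \<open>{0, h}\<close> in \<open>ker s\<close>. A
  character trivial at \<open>h\<close> but not on all of \<open>ker s\<close> separates it from the
  other coset, and its value on \<open>E\<close> is the sign \<open>\<sigma>\<close>.\<close>

lemma two_subset_ker:
  assumes "s \<noteq> 0" "E \<subseteq> ker s" "card E = 2"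
  obtains y \<sigma> where "y \<noteq> 0" "y \<noteq> s" "\<sigma> \<noteq> (0 :: real)"
    "\<And>x. x \<in> ker s \<Longrightarrow> character x y = (if x \<in> E then \<sigma> else - \<sigma>)"
proof -
  obtain e e' where E: "E = {e, e'}" "e \<noteq> e'" using assms(3) unfolding card_2_iff by blast
  define h where "h = e + e'"
  have h: "h \<noteq> 0" "h \<in> ker s" using E assms(2) by (auto simp: h_def mem_ker character_add_left)
  have e': "e' = e + h" by (simp add: h_def)
  \<comment> \<open>An element outside \<open>ker s\<close> at which \<open>y\<close> will be
    trivial: this forces \<open>y \<noteq> s\<close> and makes \<open>ker y\<close> meet
    \<open>ker s\<close> only in \<open>{0, h}\<close>.\<close>
  obtain b where b: "character b s = - 1" using ex_character_neg assms(1) by blast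
  have "b \<noteq> 0" "b \<noteq> h" using b h by (auto simp: mem_ker)
  then obtain y where y: "y \<noteq> 0" and *: "\<And>r. character r y = (if r \<in> {0, h, b, h + b} then 1 else - 1)"
    using ex_character_span[of h b] h by metis
  have "y \<noteq> s" using *[of b] b by auto
  moreover have "character x y = (if x \<in> E then character e y else - character e y)" if x: "x \<in> ker s" for x
  proof -
    have "e \<in> ker s" using E assms(2) by blast
    then have "x + e \<in> ker s" using x by (simp add: mem_ker character_add_left)
    moreover have "b \<notin> ker s" "h + b \<notin> ker s" using b h by (simp_all add: mem_ker character_add_left)
    ultimately have "x + e \<noteq> b" "x + e \<noteq> h + b" by metis+
    then have "character (x + e) y = (if x + e = 0 \<or> x + e = h then 1 else - 1)"
      by (simp add: *)
    moreover have "x + e = h \<longleftrightarrow> x = e + h" by (auto simp: add_eq_iff_z23 add.commute)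
    ultimately have "character x y * character e y = (if x \<in> E then 1 else - 1)"
      by (auto simp: character_add_left E e')
    then show ?thesis using character_cases[of e y] by (auto split: if_splits)
  qed
  ultimately show thesis using that[of y "character e y"] y by simp
qed

text \<open>The sum of the characters \<open>0\<close>, \<open>s\<close>, \<open>y\<close> and
  \<open>s + y\<close> is four times the indicator of the intersection.\<close>

lemma card_ker_Int_ker:
  assumes "s \<noteq> 0" "y \<noteq> 0" "y \<noteq> s"
  shows "card (ker s \<inter> ker y) = 2"
proof -
  have "4 * real (card (ker s \<inter> ker y)) = (\<Sum>x\<in>ker s \<inter> ker y. 4)"
    by simp
  also have "\<dots> = (\<Sum>x\<in>UNIV. if x \<in> ker s \<inter> ker y then 4 else 0)"
    by (rule sum.mono_neutral_cong_left) auto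
  also have "\<dots> = (\<Sum>x\<in>UNIV. character x 0 + character x s + character x y + character x (s + y))"
  proof (rule sum.cong)
    fix x
    show "(if x \<in> ker s \<inter> ker y then 4 else 0) = character x 0 + character x s + character x y + character x (s + y)"
      using character_cases[of x s] character_cases[of x y] by (auto simp: mem_ker character_add_right)
  qed simp
  also have "\<dots> = 8" using assms by (auto simp: sum.distrib sum_character)
  finally show ?thesis by simp
qed

text \<open>A halving of \<open>ker s\<close> is cut out by the signs of a character
  \<open>y\<close> other than \<open>0\<close> and \<open>s\<close>. The mass difference of the
  translated halves is then, up to a nonzero factor, a combination of the coefficients at
  \<open>y\<close> and \<open>y + s\<close>. \<open>G\<close> will be \<open>{0}\<close> for I.2(b)
  and \<open>{0, g}\<close> for II.3(a).\<close>

lemma ex_halving_iff: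
  assumes "s \<noteq> 0"
  shows "(\<exists>E\<subseteq>ker s. card E = 2 \<and>
      (\<forall>g\<in>G. measure_pmf.prob \<mu> ((+) g ` E) = measure_pmf.prob \<mu> ((+) g ` (ker s - E))))
    \<longleftrightarrow> (\<exists>y. y \<noteq> 0 \<and> y \<noteq> s \<and>
      (\<forall>g\<in>G. character g y * charfun \<mu> y + character g (y + s) * charfun \<mu> (y + s) = 0))"
proof -
  have prob: "measure_pmf.prob \<mu> ((+) g ` A) = (\<Sum>x\<in>A. pmf \<mu> (g + x))" for g A
    unfolding prob_eq_sum by (subst sum.reindex) auto
  have key: "(character g y * charfun \<mu> y + character g (y + s) * charfun \<mu> (y + s)) / 2
      = \<sigma> * (measure_pmf.prob \<mu> ((+) g ` E) - measure_pmf.prob \<mu> ((+) g ` (ker s - E)))"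
    if "E \<subseteq> ker s" "\<And>x. x \<in> ker s \<Longrightarrow> character x y = (if x \<in> E then \<sigma> else - \<sigma>)" for g y \<sigma> E
  proof -
    have "(\<Sum>x\<in>ker s. pmf \<mu> (g + x) * character x y)
        = (\<Sum>x\<in>ker s - E. pmf \<mu> (g + x) * character x y) + (\<Sum>x\<in>E. pmf \<mu> (g + x) * character x y)"
      using that(1) by (intro sum.subset_diff) auto
    also have "(\<Sum>x\<in>ker s - E. pmf \<mu> (g + x) * character x y) = (\<Sum>x\<in>ker s - E. - \<sigma> * pmf \<mu> (g + x))"
      by (rule sum.cong) (simp_all add: that(2))
    also have "(\<Sum>x\<in>E. pmf \<mu> (g + x) * character x y) = (\<Sum>x\<in>E. \<sigma> * pmf \<mu> (g + x))"
      by (rule sum.cong) (use that in auto)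
    finally show ?thesis
      unfolding sum_ker_translate prob by (simp add: sum_distrib_left sum_negf algebra_simps)
  qed
  show ?thesis
  proof
    assume "\<exists>E\<subseteq>ker s. card E = 2 \<and>
      (\<forall>g\<in>G. measure_pmf.prob \<mu> ((+) g ` E) = measure_pmf.prob \<mu> ((+) g ` (ker s - E)))"
    then obtain E where E: "E \<subseteq> ker s" "card E = 2"
      "\<And>g. g \<in> G \<Longrightarrow> measure_pmf.prob \<mu> ((+) g ` E) = measure_pmf.prob \<mu> ((+) g ` (ker s - E))"
      by blast
    obtain y \<sigma> where y: "y \<noteq> 0" "y \<noteq> s"
      "\<And>x. x \<in> ker s \<Longrightarrow> character x y = (if x \<in> E then \<sigma> else - \<sigma>)"
      using two_subset_ker[OF assms E(1,2)] by metis
    have "character g y * charfun \<mu> y + character g (y + s) * charfun \<mu> (y + s) = 0" if "g \<in> G" for g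
      using key[OF E(1) y(3), of g] E(3)[OF that] by simp
    with y show "\<exists>y. y \<noteq> 0 \<and> y \<noteq> s \<and>
      (\<forall>g\<in>G. character g y * charfun \<mu> y + character g (y + s) * charfun \<mu> (y + s) = 0)" by blast
  next
    assume "\<exists>y. y \<noteq> 0 \<and> y \<noteq> s \<and>
      (\<forall>g\<in>G. character g y * charfun \<mu> y + character g (y + s) * charfun \<mu> (y + s) = 0)"
    then obtain y where y: "y \<noteq> 0" "y \<noteq> s"
      "\<And>g. g \<in> G \<Longrightarrow> character g y * charfun \<mu> y + character g (y + s) * charfun \<mu> (y + s) = 0"
      by blast
    let ?E = "ker s \<inter> ker y"
    have ch: "character x y = (if x \<in> ?E then 1 else - 1)" if "x \<in> ker s" for x
      using that by (auto simp: mem_ker)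
    have "measure_pmf.prob \<mu> ((+) g ` ?E) = measure_pmf.prob \<mu> ((+) g ` (ker s - ?E))" if "g \<in> G" for g
      using key[OF _ ch, of g] y(3)[OF that] by simp
    then show "\<exists>E\<subseteq>ker s. card E = 2 \<and>
      (\<forall>g\<in>G. measure_pmf.prob \<mu> ((+) g ` E) = measure_pmf.prob \<mu> ((+) g ` (ker s - E)))"
      using card_ker_Int_ker[OF assms y(1,2)] by (intro exI[of _ ?E]) auto
  qed
qed

lemma cond_I2b_iff:
  assumes "s \<noteq> 0"
  shows "cond_I2b \<mu> (ker s) \<longleftrightarrow> (\<exists>y. y \<noteq> 0 \<and> y \<noteq> s \<and> charfun \<mu> y + charfun \<mu> (y + s) = 0)"
  using ex_halving_iff[OF assms, of "{0}"] by (simp add: cond_I2b_def)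

text \<open>Passing from \<open>0\<close> to \<open>g\<close> reverses the relative sign of the two
  terms, so their sum and their difference both vanish.\<close>

lemma halving_II3_iff:
  assumes gs: "character g s = - 1"
  shows "(\<exists>E\<subseteq>ker s. card E = 2 \<and>
      (\<forall>g\<in>{0, g}. measure_pmf.prob \<mu> ((+) g ` E) = measure_pmf.prob \<mu> ((+) g ` (ker s - E))))
    \<longleftrightarrow> (\<exists>y. y \<noteq> 0 \<and> y \<noteq> s \<and> charfun \<mu> y = 0 \<and> charfun \<mu> (y + s) = 0)"
proof -
  have *: "(\<forall>g\<in>{0, g}. character g y * charfun \<mu> y + character g (y + s) * charfun \<mu> (y + s) = 0)
      \<longleftrightarrow> charfun \<mu> y = 0 \<and> charfun \<mu> (y + s) = 0" for y
    using character_cases[of g y] by (auto simp: character_add_right gs)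
  have "s \<noteq> 0" using gs by auto
  from ex_halving_iff[OF this, where G = "{0, g}" and \<mu> = \<mu>] show ?thesis unfolding * .
qed

lemma ex_z23_notin4: "\<exists>w::z23. w \<notin> {a, b, c, d}"
proof -
  have "card {a, b, c, d} < 8" by (simp add: card_insert_if)
  then show ?thesis by (rule ex_z23_notin)
qed

lemma add_eq_swap_z23: "x + y = z \<longleftrightarrow> y = x + (z::z23)"
  by (metis add_add_self_z23)

subsection \<open>Masses at most $1/4$\<close>

lemma feasible_coflip_0_iff: "feasible \<mu> (coflip 0) \<longleftrightarrow> (\<forall>x. pmf \<mu> x \<le> 1 / 4)"
  by (simp add: feasible_def twist_coflip_0)

lemma admissibleI_infeasible: "\<not> feasible \<mu> e \<Longrightarrow> admissible \<mu> e"
  by (simp add: admissible_def)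

lemma admissibleI_sim: "sim \<mu> e (\<lambda>_. 1) \<Longrightarrow> admissible \<mu> e"
  by (simp add: admissible_def)

lemma sim_one_iff: "sim \<mu> e (\<lambda>_. 1) \<longleftrightarrow> (\<exists>k. \<forall>y. charfun \<mu> y \<noteq> 0 \<longrightarrow> e y = character k y)"
  by (simp add: sim_def)

context
  fixes \<mu> :: "z23 pmf" and g :: z23
  assumes line: "\<And>y. y \<noteq> 0 \<Longrightarrow> character g y = 1 \<Longrightarrow> charfun \<mu> y = 0"
begin

lemma neg_of_charfun: "charfun \<mu> y \<noteq> 0 \<Longrightarrow> y \<noteq> 0 \<Longrightarrow> character g y = - 1"
  using line[of y] character_neq by blast

text \<open>At every point other than \<open>0\<close> where \<open>charfun \<mu>\<close> survives,
  the character \<open>g\<close> is \<open>- 1\<close>, so there it agrees with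
  \<open>coflip 0\<close>. Multiplication by it also identifies \<open>flip r\<close> with
  \<open>coflip r\<close>.\<close>

lemma sim_coflip_0_line: "sim \<mu> (coflip 0) (\<lambda>_. 1)"
  by (rule simI[of _ _ g]) (auto simp: coflip_def neg_of_charfun)

lemma sim_coflip_one_line: "charfun \<mu> r = 0 \<Longrightarrow> sim \<mu> (coflip r) (\<lambda>_. 1)"
  by (rule simI[of _ _ g]) (auto simp: coflip_def neg_of_charfun)

lemma sim_flip_coflip_line: "r \<noteq> 0 \<Longrightarrow> sim \<mu> (flip r) (coflip r)"
  by (rule simI[of _ _ g]) (auto simp: coflip_def flip_def neg_of_charfun)

text \<open>For \<open>r \<noteq> s\<close> the sum \<open>r + s\<close> lies on the line of zeros,
  which makes \<open>flip r\<close> similar to \<open>coflip s\<close>, while it is also similar to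
  \<open>coflip r\<close>. Thus at most one nontrivial class is left.\<close>

lemma sim_coflip_coflip_line:
  assumes "character g r = - 1" "character g s = - 1"
  shows "sim \<mu> (coflip r) (coflip s)"
proof (cases "r = s")
  case False
  have r: "r \<noteq> 0" and s: "s \<noteq> 0" using assms by auto
  have "charfun \<mu> (r + s) = 0" using False assms by (intro line) (simp_all add: character_add_right)
  then have "sim \<mu> (flip r) (coflip s)" using sim_flip_coflip[of \<mu> "r + s" r] r s by auto
  then show ?thesis using sim_flip_coflip_line[OF r] sim_sym sim_trans by metis
qed (simp add: sim_refl)

lemma TEC_line_iff:
  assumes "character g s = - 1"
  shows "\<mu> \<in> TEC \<longleftrightarrow> admissible \<mu> (coflip s)"
proof
  have "s \<noteq> 0" using assms by auto
  then show "\<mu> \<in> TEC \<Longrightarrow> admissible \<mu> (coflip s)" by (simp add: TEC_iff)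
next
  assume s: "admissible \<mu> (coflip s)"
  have "admissible \<mu> (flip r) \<and> admissible \<mu> (coflip r)" if r: "r \<noteq> 0" for r
  proof (cases "character g r = 1")
    case True
    then have "charfun \<mu> r = 0" using line r by blast
    then show ?thesis using r by (simp add: admissibleI_sim sim_flip_one sim_coflip_one_line)
  next
    case False
    then have "admissible \<mu> (coflip r)"
      using sim_coflip_coflip_line[of r s] assms s sim_admissible by simp
    then show ?thesis using sim_flip_coflip_line[OF r] sim_admissible by blast
  qed
  then show "\<mu> \<in> TEC" by (simp add: TEC_iff admissibleI_sim sim_coflip_0_line)
qed

text \<open>The product of a character over the affine plane \<open>{y. character g y = - 1}\<close> is \<open>1\<close>, the
  product of \<open>coflip s\<close> is \<open>- 1\<close>.\<close>

lemma sim_coflip_one_line_iff: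
  assumes s: "character g s = - 1"
  shows "sim \<mu> (coflip s) (\<lambda>_. 1) \<longleftrightarrow> (\<exists>z. character g z = - 1 \<and> charfun \<mu> z = 0)"
proof
  assume "\<exists>z. character g z = - 1 \<and> charfun \<mu> z = 0"
  then show "sim \<mu> (coflip s) (\<lambda>_. 1)"
    using sim_coflip_coflip_line[OF s] sim_coflip_one_line sim_trans by blast
next
  assume "sim \<mu> (coflip s) (\<lambda>_. 1)"
  then obtain k where k: "\<And>y. charfun \<mu> y \<noteq> 0 \<Longrightarrow> coflip s y = character k y"
    unfolding sim_one_iff by blast
  have g: "g \<noteq> 0" using s by auto
  obtain a b where ab: "a \<in> ker g" "b \<in> ker g" "a \<noteq> 0" "b \<noteq> 0" "a \<noteq> b"
    using four_set_span[of "ker g"] card_ker[OF g] subgrp_ker[of g] unfolding subgrp_def by metis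
  show "\<exists>z. character g z = - 1 \<and> charfun \<mu> z = 0"
  proof (rule ccontr)
    assume "\<not> ?thesis"
    then have P: "coflip s y = character k y" if "character g y = - 1" for y
      using k that by blast
    have "character k s = 1" using P[OF s] by (simp add: coflip_def)
    moreover have "character k (s + c) = - 1" if "c \<in> ker g" "c \<noteq> 0" for c
    proof -
      have "character g (s + c) = - 1" using s that by (simp add: character_add_right mem_ker character_commute[of g c])
      moreover have "s + c \<noteq> 0" using calculation by auto
      ultimately show ?thesis using P[of "s + c"] that by (simp add: coflip_def)
    qed
    ultimately have "character k c = - 1" if "c \<in> ker g" "c \<noteq> 0" for c
      using that by (simp add: character_add_right)
    \<comment> \<open>A character cannot be \<open>- 1\<close> at all three of \<open>a\<close>,
      \<open>b\<close> and \<open>a + b\<close>.\<close>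
    from this[of a] this[of b] this[of "a + b"] ab show False
      by (simp add: character_add_right mem_ker character_add_left)
  qed
qed

end

lemma cond_I2c_iff:
  "cond_I2c \<mu> {0, g} \<longleftrightarrow> (\<exists>s0. character g s0 = - 1 \<and> \<mu> \<in> U_set (ker s0) \<and>
    (\<forall>s. character g s = - 1 \<and> s \<noteq> s0 \<longrightarrow>
      (\<forall>z. z \<notin> ker s \<and> z \<notin> {0, g} \<and> z \<notin> ker s0 \<longrightarrow> u_max \<mu> (- ker s) = pmf \<mu> z)))"
proof -
  have "s \<noteq> 0" if "character g s = - 1" for s using that by auto
  then show ?thesis
    unfolding cond_I2c_def bex_subgroups2 ball_subgroups2 subset_ker_iff ker_inject character_neq Compl_iff
    by metis
qed

text \<open>The negative value can be moved to the point \<open>0\<close> at the price of replacing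
  \<open>s\<close> by some \<open>r\<close>. Then \<open>0\<close> carries more than half of the
  mass of \<open>ker r\<close>, and \<open>quarter\<close> turns this into the required maxima off
  the other kernels.\<close>

lemma cond_I2c_if_infeasible:
  assumes max: "\<And>x. pmf \<mu> x \<le> pmf \<mu> 0"
    and quarter: "\<And>x. pmf \<mu> x + pmf \<mu> (x + g) = 1 / 4"
    and s: "character g s = - 1" and inf: "\<not> feasible \<mu> (coflip s)"
  shows "cond_I2c \<mu> {0, g}"
proof -
  have g: "g \<noteq> 0" and s0: "s \<noteq> 0" using s by auto
  have line: "charfun \<mu> y = 0" if "y \<noteq> 0" "character g y = 1" for y
    using sum_quarter_iff quarter that by blast
  have small: "pmf \<mu> 0 \<le> 1 / 4" using quarter[of 0] by (smt (verit) pmf_nonneg)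
  obtain x where x: "twist \<mu> (coflip s) x < 0" using inf by (auto simp: feasible_def not_le)
  have "\<exists>r. character g r = - 1 \<and> twist \<mu> (coflip r) 0 < 0"
  proof -
    consider "x \<in> ker s" | "x = g" | "x \<notin> ker s" "x \<noteq> g" by blast
    then show ?thesis
    proof cases
      case 1
      have "twist \<mu> (coflip s) 0 < 0"
        using x 1 max[of x] by (simp add: twist_coflip[OF s0] mem_ker)
      with s show ?thesis by blast
    next
      \<comment> \<open>This case is contradictory: for \<open>c = charfun \<mu> s\<close> the
        bounds \<open>(1 + c) / 2 \<le> 4 * pmf \<mu> 0\<close> and
        \<open>4 * pmf \<mu> 0 < c\<close> force \<open>c > 1\<close>, while \<open>small\<close>
        forces \<open>c \<le> 1\<close>.\<close>
      case 2
      then have "pmf \<mu> 0 < charfun \<mu> s / 4"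
        using x s quarter[of 0] by (simp add: twist_coflip[OF s0])
      moreover have "(\<Sum>z\<in>ker s. pmf \<mu> z) \<le> 4 * pmf \<mu> 0"
        using sum_bounded_above[of "ker s" "pmf \<mu>" "pmf \<mu> 0"] max card_ker[OF s0] by simp
      then have "(1 + charfun \<mu> s) / 2 \<le> 4 * pmf \<mu> 0" by (simp flip: prob_ker prob_eq_sum)
      ultimately show ?thesis using small by (simp add: field_simps)
    next
      case 3
      \<comment> \<open>Translation by \<open>x\<close> will carry \<open>coflip s\<close> to
        \<open>coflip r\<close> off the zeros, where \<open>s\<close> and \<open>r\<close> are the
        two points of \<open>ker k\<close> at which \<open>g\<close> is \<open>- 1\<close>.\<close>
      define k where "k = x + g"
      have k0: "k \<noteq> 0" and ks: "character s k = 1"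
        using 3 s by (auto simp: k_def character_add_left character_commute[of s] not_mem_ker)
      have "\<not> ker k \<subseteq> {0, s}" using card_mono[of "{0, s}" "ker k"] card_ker[OF k0] s0 by auto
      then obtain u where u: "u \<in> ker k" "u \<noteq> 0" "u \<noteq> s" by blast
      define r where "r = (if character g u = - 1 then u else u + s)"
      have r: "r \<in> ker k" "r \<noteq> 0" "r \<noteq> s" "character g r = - 1"
        using u ks s character_cases[of g u] by (auto simp: r_def mem_ker character_add_left character_add_right)
      have kerk: "ker k = {0, s, r, s + r}"
        using ks r s0 k0 by (intro ker_eq_span) (auto simp: mem_ker)
      have "coflip s y = character x y * coflip r y" if y: "charfun \<mu> y \<noteq> 0" for y
      proof (cases "y = 0")
        case False
        then have gy: "character g y = - 1" using line y character_neq by blast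
        have "x = k + g" by (simp add: k_def add.assoc)
        then have xy: "character x y = - character y k" by (simp add: gy character_add_left character_commute[of k])
        have "y \<noteq> s + r" using gy s r by (auto simp: character_add_right)
        then have "character y k = (if y = s \<or> y = r then 1 else - 1)"
          using kerk False mem_ker[of y k] by (auto simp flip: character_neq)
        then show ?thesis using False r(3) by (auto simp: xy coflip_def)
      qed (simp add: coflip_def)
      then have "twist \<mu> (coflip s) x = twist \<mu> (coflip r) (x + x)" by (rule twist_shift)
      then show ?thesis using x r(4) by auto
    qed
  qed
  then obtain r where r: "character g r = - 1" "twist \<mu> (coflip r) 0 < 0" by blast
  have r0: "r \<noteq> 0" using r by auto
  have dom: "measure_pmf.prob \<mu> (ker r) < 2 * pmf \<mu> 0"
    using r(2) by (simp add: twist_coflip[OF r0] prob_ker field_simps)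
  have two: "pmf \<mu> w + pmf \<mu> w' < pmf \<mu> 0"
    if "w \<in> ker r" "w' \<in> ker r" "w \<noteq> 0" "w' \<noteq> 0" "w \<noteq> w'" for w w'
  proof -
    have "sum (pmf \<mu>) {0, w, w'} \<le> sum (pmf \<mu>) (ker r)"
      using that by (intro sum_mono2) (auto simp: mem_ker)
    then show ?thesis using dom that by (simp add: prob_eq_sum)
  qed
  \<comment> \<open>By \<open>quarter\<close>, the mass of \<open>z\<close> is large because that of
    \<open>z + g\<close> is small. A competitor \<open>y\<close> in \<open>ker r\<close> is handled
    by \<open>two\<close>; otherwise \<open>y + g\<close> is \<open>0\<close> or
    \<open>z + g\<close>, and maximality of the mass at \<open>0\<close> decides.\<close>
  have "u_max \<mu> (- ker t) = pmf \<mu> z"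
    if t: "character g t = - 1" "t \<noteq> r" and z: "z \<notin> ker t" "z \<notin> {0, g}" "z \<notin> ker r" for t z
    unfolding u_max_image
  proof (rule Max_eqI)
    have t0: "t \<noteq> 0" using t by auto
    have zr: "z + g \<in> ker r" and zt: "z + g \<in> ker t" and zg: "z + g \<noteq> 0"
      using z r t by (auto simp: mem_ker character_add_left)
    have qz: "pmf \<mu> z = 1 / 4 - pmf \<mu> (z + g)" using quarter[of z] by simp
    fix p assume "p \<in> pmf \<mu> ` (- ker t)"
    then obtain y where y: "y \<notin> ker t" "p = pmf \<mu> y" by blast
    show "p \<le> pmf \<mu> z"
    proof (cases "y \<in> ker r")
      case True
      have "y \<noteq> 0" "y \<noteq> z + g" using y zt by (auto simp: mem_ker)
      then have "pmf \<mu> y + pmf \<mu> (z + g) < pmf \<mu> 0" using two True zr zg by blast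
      then show ?thesis using small y qz by simp
    next
      case False
      have mem: "y + g \<in> ker t \<inter> ker r" "z + g \<in> ker t \<inter> ker r" "0 \<in> ker t \<inter> ker r"
        using y False r t zr zt by (auto simp: mem_ker character_add_left)
      have "ker t \<inter> ker r = {0, z + g}"
        using card_subset_eq[of "ker t \<inter> ker r" "{0, z + g}"] card_ker_Int_ker[OF t0 r0] t(2) mem zg by auto
      then have "y + g = 0 \<or> y + g = z + g" using mem(1) by blast
      then have "pmf \<mu> (z + g) \<le> pmf \<mu> (y + g)" using max[of "z + g"] by auto
      then show ?thesis using quarter[of y] y qz by simp
    qed
  qed (use z in auto)
  moreover have "\<mu> \<in> U_set (ker r)"
    unfolding U_set_iff[OF ker_nonempty] using dom mem_ker by (intro bexI[of _ 0]) auto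
  ultimately show ?thesis unfolding cond_I2c_iff using r(1) by blast
qed

lemma TEC_iff_small:
  assumes max: "\<And>x. pmf \<mu> x \<le> pmf \<mu> 0" and small: "pmf \<mu> 0 \<le> 1 / 4"
  shows "\<mu> \<in> TEC \<longleftrightarrow> (\<exists>g s. character g s = - 1 \<and> cond_I1 \<mu> {0, g} (ker s) \<and> cond_I2 \<mu> {0, g} (ker s))"
proof
  assume TEC: "\<mu> \<in> TEC"
  have "feasible \<mu> (coflip 0)" unfolding feasible_coflip_0_iff using max small order_trans by blast
  then have "sim \<mu> (coflip 0) (\<lambda>_. 1)" using TEC by (simp add: TEC_iff admissible_def)
  then obtain k where k: "\<And>y. charfun \<mu> y \<noteq> 0 \<Longrightarrow> coflip 0 y = character k y"
    unfolding sim_one_iff by blast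
  \<comment> \<open>If \<open>k = 0\<close>, then \<open>charfun \<mu>\<close> vanishes off
    \<open>0\<close> and any nonzero \<open>g\<close> will do.\<close>
  define g where "g = (if k = 0 then (1, 1, 1) else k)"
  have g: "g \<noteq> 0" by (simp add: g_def zero_prod_def)
  have line: "charfun \<mu> y = 0" if y: "y \<noteq> 0" "character g y = 1" for y
  proof (rule ccontr)
    assume "charfun \<mu> y \<noteq> 0"
    then have "character k y = - 1" using k[of y] y by (simp add: coflip_def)
    with y show False by (auto simp: g_def split: if_splits)
  qed
  obtain s where s: "character g s = - 1" using ex_character_neg[OF g] character_commute by metis
  then have s0: "s \<noteq> 0" by auto
  have quarter: "\<forall>x. pmf \<mu> x + pmf \<mu> (x + g) = 1 / 4" using sum_quarter_iff line by blast
  have "cond_I2 \<mu> {0, g} (ker s)"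
  \<comment> \<open>A feasible \<open>coflip s\<close> forces a zero \<open>z\<close> off the line:
    \<open>z = s\<close> gives (a), any other \<open>z\<close> gives (b) because
    \<open>z + s\<close> is on the line. An infeasible one gives (c).\<close>
  proof (cases "feasible \<mu> (coflip s)")
    case True
    then have "sim \<mu> (coflip s) (\<lambda>_. 1)" using TEC s0 by (simp add: TEC_iff admissible_def)
    then obtain z where z: "character g z = - 1" "charfun \<mu> z = 0"
      using sim_coflip_one_line_iff[OF line s] by blast
    show ?thesis
    proof (cases "z = s")
      case True
      then show ?thesis using z haar_line_iff[OF s] by (simp add: cond_I2_def cond_I2a_def)
    next
      case False
      then have "charfun \<mu> (z + s) = 0" using s z by (intro line) (auto simp: character_add_right)
      moreover have "z \<noteq> 0" using z by auto
      ultimately have "cond_I2b \<mu> (ker s)" unfolding cond_I2b_iff[OF s0] using z False by (intro exI[of _ z]) simp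
      then show ?thesis by (simp add: cond_I2_def)
    qed
  next
    case False
    then have "cond_I2c \<mu> {0, g}" using cond_I2c_if_infeasible[of \<mu> g s] max quarter s by blast
    then show ?thesis by (simp add: cond_I2_def)
  qed
  then show "\<exists>g s. character g s = - 1 \<and> cond_I1 \<mu> {0, g} (ker s) \<and> cond_I2 \<mu> {0, g} (ker s)"
    using s quarter cond_I1_iff[OF s] by blast
next
  assume "\<exists>g s. character g s = - 1 \<and> cond_I1 \<mu> {0, g} (ker s) \<and> cond_I2 \<mu> {0, g} (ker s)"
  then obtain g s where s: "character g s = - 1" and I: "cond_I1 \<mu> {0, g} (ker s)" "cond_I2 \<mu> {0, g} (ker s)"
    by blast
  have s0: "s \<noteq> 0" using s by auto
  have line: "charfun \<mu> y = 0" if "y \<noteq> 0" "character g y = 1" for y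
    using I(1) that unfolding cond_I1_iff[OF s] sum_quarter_iff by blast
  consider "charfun \<mu> s = 0" | y where "y \<noteq> 0" "y \<noteq> s" "charfun \<mu> y + charfun \<mu> (y + s) = 0" | "cond_I2c \<mu> {0, g}"
    using I(2) unfolding cond_I2_def cond_I2a_def haar_line_iff[OF s] cond_I2b_iff[OF s0] by blast
  then show "\<mu> \<in> TEC"
  proof cases
    case 1
    then have "sim \<mu> (coflip s) (\<lambda>_. 1)" using sim_coflip_one_line_iff[OF line s] s by blast
    then show ?thesis using TEC_line_iff[OF line s] admissibleI_sim by blast
  next
    case 2
    \<comment> \<open>One of \<open>y\<close> and \<open>y + s\<close> lies on the line of zeros, so
      the other is a zero off it.\<close>
    have "\<exists>z. character g z = - 1 \<and> charfun \<mu> z = 0"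
    proof (cases "character g y = 1")
      case True
      then have "charfun \<mu> (y + s) = 0" using line[of y] 2 by simp
      then show ?thesis using True s by (intro exI[of _ "y + s"]) (simp add: character_add_right)
    next
      case False
      then have "charfun \<mu> (y + s) = 0" using 2 s by (intro line) (auto simp: character_add_right)
      then show ?thesis using False 2 by (intro exI[of _ y]) simp
    qed
    then have "sim \<mu> (coflip s) (\<lambda>_. 1)" using sim_coflip_one_line_iff[OF line s] by blast
    then show ?thesis using TEC_line_iff[OF line s] admissibleI_sim by blast
  next
    case 3
    then obtain r where r: "character g r = - 1" "\<mu> \<in> U_set (ker r)" unfolding cond_I2c_iff by blast
    have "r \<noteq> 0" using r(1) by auto
    then have "\<not> feasible \<mu> (coflip r)" using feasible_coflip_iff r(2) by blast
    then show ?thesis using TEC_line_iff[OF line r(1)] admissibleI_infeasible by blast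
  qed
qed

subsection \<open>A mass greater than $1/4$\<close>

text \<open>The product of a character over a line is \<open>1\<close>, whereas
  \<open>coflip r\<close> is \<open>- 1\<close> at all three points of a line missing
  \<open>r\<close>. The next lemma uses the same product for \<open>flip r\<close> on a line through
  \<open>r\<close>.\<close>

lemma not_sim_coflip_one:
  assumes "a \<noteq> 0" "b \<noteq> 0" "a \<noteq> b" "r \<notin> {a, b, a + b}"
    and "charfun \<mu> a \<noteq> 0" "charfun \<mu> b \<noteq> 0" "charfun \<mu> (a + b) \<noteq> 0"
  shows "\<not> sim \<mu> (coflip r) (\<lambda>_. 1)"
proof
  assume "sim \<mu> (coflip r) (\<lambda>_. 1)"
  then obtain k where "\<And>y. charfun \<mu> y \<noteq> 0 \<Longrightarrow> coflip r y = character k y"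
    unfolding sim_one_iff by blast
  from this[OF assms(5)] this[OF assms(6)] this[OF assms(7)] assms(1-4) show False
    by (auto simp: coflip_def character_add_right)
qed

lemma not_sim_flip_one:
  assumes "r \<noteq> 0" "b \<noteq> 0" "b \<noteq> r"
    and "charfun \<mu> r \<noteq> 0" "charfun \<mu> b \<noteq> 0" "charfun \<mu> (r + b) \<noteq> 0"
  shows "\<not> sim \<mu> (flip r) (\<lambda>_. 1)"
proof
  assume "sim \<mu> (flip r) (\<lambda>_. 1)"
  then obtain k where "\<And>y. charfun \<mu> y \<noteq> 0 \<Longrightarrow> flip r y = character k y"
    unfolding sim_one_iff by blast
  from this[OF assms(4)] this[OF assms(5)] this[OF assms(6)] assms(1-3) show False
    by (auto simp: flip_def character_add_right)
qed

text \<open>Sign changes at the two zeros \<open>y\<close> and \<open>y + s\<close> are invisible,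
  and together they amount to \<open>coflip s\<close> times a character.\<close>

lemma sim_coflip_pair:
  assumes "charfun \<mu> y = 0" "charfun \<mu> (y + s) = 0" "s \<noteq> 0" "y \<noteq> s"
  shows "sim \<mu> (coflip s) (\<lambda>_. 1)"
proof -
  have y: "y \<noteq> 0" using assms(1) by auto
  then obtain k where k: "\<And>u. flip y u * flip (y + s) u = character k u * coflip s u"
    using flip_mult_flip[of y "y + s"] assms(3,4) by auto
  have "coflip s u = character k u" if "charfun \<mu> u \<noteq> 0" for u
  proof -
    have "character k u * coflip s u = 1" using that assms(1,2) unfolding k[symmetric] by (auto simp: flip_def)
    then show ?thesis using character_cases[of k u] by auto
  qed
  then show ?thesis unfolding sim_one_iff by blast
qed

lemma ex_line_avoiding:
  assumes "r \<noteq> 0" "s \<noteq> 0"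
  shows "\<exists>a b :: z23. a \<noteq> 0 \<and> b \<noteq> 0 \<and> a \<noteq> b \<and> r \<notin> {a, b, a + b} \<and> s \<notin> {a, b, a + b}"
proof (cases "r = s")
  case True
  obtain t where t: "t \<notin> {0, r, 0, r}" by (rule exE[OF ex_z23_notin4])
  obtain u where u: "u \<notin> {0, r, t, r + t}" by (rule exE[OF ex_z23_notin4])
  have "t + u = r \<longleftrightarrow> u = r + t" by (simp add: add_eq_swap_z23 add.commute)
  with t u True show ?thesis by (intro exI[of _ t] exI[of _ u]) auto
next
  case False
  \<comment> \<open>With \<open>t\<close> off the line through \<open>r\<close> and
    \<open>s\<close>, the line of \<open>r + t\<close>, \<open>s + t\<close> and
    \<open>r + s\<close> misses both points.\<close>
  obtain t where t: "t \<notin> {0, r, s, r + s}" by (rule exE[OF ex_z23_notin4])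
  have *: "r + t = s \<longleftrightarrow> t = r + s" "s + t = r \<longleftrightarrow> t = r + s"
    by (simp_all add: add_eq_swap_z23 add.commute)
  have "(r + t) + (s + t) = r + s" by (simp add: add.assoc add.left_commute)
  with t * False assms show ?thesis by (intro exI[of _ "r + t"] exI[of _ "s + t"]) auto
qed

section \<open>Conditions II.1 to II.4 as zeros and infeasible patterns\<close>

lemma cond_II1_iff:
  "cond_II1 \<mu> \<longleftrightarrow> (\<forall>s. s \<noteq> 0 \<longrightarrow> \<not> feasible \<mu> (coflip s) \<and> \<not> feasible \<mu> (flip s))"
  unfolding cond_II1_def ball_subgroups2 using feasible_coflip_iff feasible_flip_iff by auto

lemma cond_II2_iff:
  "cond_II2 \<mu> {0, g} \<longleftrightarrow>
    (\<exists>s. character g s = - 1 \<and> (\<forall>y. y \<noteq> s \<and> character g y = - 1 \<longrightarrow> charfun \<mu> y = 0)) \<and>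
    (\<forall>r. character g r = - 1 \<longrightarrow> \<not> feasible \<mu> (coflip r))"
proof -
  have nz: "s \<noteq> 0" if "character g s = - 1" for s using that by auto
  have "(\<exists>K\<in>\<AA>\<^sub>2. \<not> {0, g} \<subseteq> K \<and> \<mu> \<in> W_set {0, g} K) \<longleftrightarrow>
      (\<exists>s. character g s = - 1 \<and> (\<forall>y. y \<noteq> s \<and> character g y = - 1 \<longrightarrow> charfun \<mu> y = 0))"
    unfolding bex_subgroups2 subset_ker_iff character_neq using W_set_iff nz by blast
  moreover have "(\<forall>K\<in>\<AA>\<^sub>2. \<not> {0, g} \<subseteq> K \<longrightarrow> \<mu> \<in> U_set K \<or> \<mu> \<in> U_set (- K)) \<longleftrightarrow>
      (\<forall>r. character g r = - 1 \<longrightarrow> \<not> feasible \<mu> (coflip r))"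
    unfolding ball_subgroups2 subset_ker_iff character_neq using feasible_coflip_iff nz by metis
  ultimately show ?thesis by (simp only: cond_II2_def)
qed

lemma cond_II3_iff:
  assumes gs: "character g s = - 1"
  shows "cond_II3 \<mu> {0, g} (ker s) \<longleftrightarrow>
    (\<exists>y. y \<noteq> 0 \<and> y \<noteq> s \<and> charfun \<mu> y = 0 \<and> charfun \<mu> (y + s) = 0) \<and>
    (\<forall>r. r \<noteq> 0 \<and> r \<noteq> s \<longrightarrow> \<not> feasible \<mu> (coflip r))"
proof -
  have "(\<forall>K\<in>\<AA>\<^sub>2. K \<noteq> ker s \<longrightarrow> \<mu> \<in> U_set K \<or> \<mu> \<in> U_set (- K)) \<longleftrightarrow>
      (\<forall>r. r \<noteq> 0 \<and> r \<noteq> s \<longrightarrow> \<not> feasible \<mu> (coflip r))"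
    unfolding ball_subgroups2 ker_inject using feasible_coflip_iff by blast
  then show ?thesis unfolding cond_II3_def halving_II3_iff[OF gs] by (simp only:)
qed

lemma cond_II4_iff:
  assumes gs: "character g s = - 1"
  shows "cond_II4 \<mu> {0, g} (ker s) \<longleftrightarrow> charfun \<mu> s = 0 \<and>
    (\<forall>r. r \<noteq> 0 \<and> r \<noteq> s \<longrightarrow> \<not> feasible \<mu> (flip r)) \<and> (\<forall>r. r \<noteq> 0 \<longrightarrow> \<not> feasible \<mu> (coflip r))"
proof -
  have "(\<forall>K\<in>\<AA>\<^sub>2. K \<noteq> ker s \<longrightarrow> \<mu> \<in> V_set K \<or> \<mu> \<in> V_set (- K)) \<longleftrightarrow>
      (\<forall>r. r \<noteq> 0 \<and> r \<noteq> s \<longrightarrow> \<not> feasible \<mu> (flip r))"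
    unfolding ball_subgroups2 ker_inject using feasible_flip_iff by blast
  moreover have "(\<forall>K\<in>\<AA>\<^sub>2. \<mu> \<in> U_set K \<or> \<mu> \<in> U_set (- K)) \<longleftrightarrow>
      (\<forall>r. r \<noteq> 0 \<longrightarrow> \<not> feasible \<mu> (coflip r))"
    unfolding ball_subgroups2 using feasible_coflip_iff by blast
  ultimately show ?thesis unfolding cond_II4_def haar_line_iff[OF gs] by (simp only:)
qed

lemma TEC_if_large:
  assumes large: "pmf \<mu> 0 > 1 / 4" and s: "character g s = - 1"
    and II: "cond_II1 \<mu> \<or> cond_II2 \<mu> {0, g} \<or> cond_II3 \<mu> {0, g} (ker s) \<or> cond_II4 \<mu> {0, g} (ker s)"
  shows "\<mu> \<in> TEC"
proof -
  have s0: "s \<noteq> 0" using s by auto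
  have "\<not> feasible \<mu> (coflip 0)" unfolding feasible_coflip_0_iff using large not_le by blast
  then have adm0: "admissible \<mu> (coflip 0)" by (rule admissibleI_infeasible)
  \<comment> \<open>A zero \<open>y\<close> converts \<open>flip r\<close> into
    \<open>coflip (r + y)\<close>, so infeasible coflips take care of flips too.\<close>
  have flip_inf: "admissible \<mu> (flip r)"
    if "charfun \<mu> y = 0" "y \<noteq> r" "r \<noteq> 0" "\<not> feasible \<mu> (coflip (r + y))" for r y
    using sim_flip_coflip[OF that(1-3)] admissibleI_infeasible[OF that(4)] by (rule sim_admissible)
  have "admissible \<mu> (flip r) \<and> admissible \<mu> (coflip r)" if r: "r \<noteq> 0" for r
    using II
  proof (elim disjE)
    assume "cond_II1 \<mu>"
    then show ?thesis using r unfolding cond_II1_iff by (simp add: admissibleI_infeasible)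
  next
    assume "cond_II4 \<mu> {0, g} (ker s)"
    then have "charfun \<mu> s = 0" "r \<noteq> s \<Longrightarrow> \<not> feasible \<mu> (flip r)" "\<not> feasible \<mu> (coflip r)"
      using r unfolding cond_II4_iff[OF s] by blast+
    then show ?thesis
      by (cases "r = s") (simp_all add: admissibleI_infeasible admissibleI_sim sim_flip_one)
  next
    assume "cond_II3 \<mu> {0, g} (ker s)"
    then obtain y where y: "y \<noteq> 0" "y \<noteq> s" "charfun \<mu> y = 0" "charfun \<mu> (y + s) = 0"
      and inf: "\<And>r. r \<noteq> 0 \<Longrightarrow> r \<noteq> s \<Longrightarrow> \<not> feasible \<mu> (coflip r)"
      unfolding cond_II3_iff[OF s] by blast
    have "admissible \<mu> (coflip r)"
      using inf[OF r] sim_coflip_pair[OF y(3,4) s0 y(2)] admissibleI_infeasible admissibleI_sim by blast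
    moreover have "admissible \<mu> (flip r)"
    proof (cases "r = y \<or> r = y + s")
      case True
      then show ?thesis using y by (auto intro: admissibleI_sim sim_flip_one)
    next
      case False
      have "r + y \<noteq> s" using False by (simp add: add_eq_iff_z23 add.commute)
      then show ?thesis using False r y inf by (intro flip_inf[of y]) auto
    qed
    ultimately show ?thesis by blast
  next
    assume "cond_II2 \<mu> {0, g}"
    then obtain t where t: "character g t = - 1"
      and Z: "\<And>y. y \<noteq> t \<Longrightarrow> character g y = - 1 \<Longrightarrow> charfun \<mu> y = 0"
      and inf: "\<And>r. character g r = - 1 \<Longrightarrow> \<not> feasible \<mu> (coflip r)"
      unfolding cond_II2_iff by blast
    show ?thesis
    proof (cases "character g r = - 1")
      case True
      have "sim \<mu> (flip r) (\<lambda>_. 1)"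
      proof (cases "r = t")
        case True
        \<comment> \<open>Off its zeros \<open>charfun \<mu>\<close> lives on \<open>ker g\<close>
          and the point \<open>t\<close>, where \<open>flip t\<close> is the character
          \<open>g\<close>.\<close>
        have "flip t y = character g y" if "charfun \<mu> y \<noteq> 0" for y
          using that Z[of y] t character_cases[of g y] by (auto simp: flip_def)
        then show ?thesis unfolding sim_one_iff True by blast
      qed (use Z True sim_flip_one in blast)
      then show ?thesis using inf True by (simp add: admissibleI_sim admissibleI_infeasible)
    next
      case False
      then have gr: "character g r = 1" using character_cases by blast
      have g0: "g \<noteq> 0" using t by auto
      \<comment> \<open>Such a \<open>y\<close> gives two zeros \<open>y\<close> and
        \<open>y + r\<close>: as a pair they make \<open>coflip r\<close> trivial, and
        \<open>y\<close> alone turns \<open>flip r\<close> into an infeasible coflip.\<close>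
      have "\<exists>y. character g y = - 1 \<and> y \<noteq> t \<and> y \<noteq> t + r"
      proof -
        have "\<not> ker g \<subseteq> {0, r}" using card_mono[of "{0, r}" "ker g"] card_ker[OF g0] r by auto
        then obtain v where v: "v \<in> ker g" "v \<noteq> 0" "v \<noteq> r" by blast
        then have "character g (t + v) = - 1"
          using t by (simp add: character_add_right mem_ker character_commute[of g v])
        then show ?thesis using v by (intro exI[of _ "t + v"]) auto
      qed
      then obtain y where y: "character g y = - 1" "y \<noteq> t" "y \<noteq> t + r" by blast
      have yr: "character g (y + r) = - 1" "y + r \<noteq> t" using y gr by (auto simp: character_add_right add_eq_iff_z23)
      have "y \<noteq> r" using y gr by auto
      have "sim \<mu> (coflip r) (\<lambda>_. 1)"
        using sim_coflip_pair[of \<mu> y r] Z y yr r \<open>y \<noteq> r\<close> by blast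
      moreover have "admissible \<mu> (flip r)"
        using flip_inf[of y r] Z y yr r \<open>y \<noteq> r\<close> inf by (simp add: add.commute)
      ultimately show ?thesis using admissibleI_sim by blast
    qed
  qed
  then show ?thesis using adm0 by (simp add: TEC_iff)
qed

text \<open>Every pattern that is not a character off the zeros must be infeasible. The zeros
  contain no line, so their number and position decide which patterns these are.\<close>

lemma TEC_only_if_large:
  assumes TEC: "\<mu> \<in> TEC" and large: "pmf \<mu> 0 > 1 / 4"
  shows "\<exists>g s. character g s = - 1 \<and>
    (cond_II1 \<mu> \<or> cond_II2 \<mu> {0, g} \<or> cond_II3 \<mu> {0, g} (ker s) \<or> cond_II4 \<mu> {0, g} (ker s))"
proof -
  have adm: "admissible \<mu> (flip r)" "admissible \<mu> (coflip r)" if "r \<noteq> 0" for r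
    using TEC that by (simp_all add: TEC_iff)
  have infC: "\<not> feasible \<mu> (coflip r)" if "r \<noteq> 0" "\<not> sim \<mu> (coflip r) (\<lambda>_. 1)" for r
    using adm(2)[OF that(1)] that(2) unfolding admissible_def by blast
  have infF: "\<not> feasible \<mu> (flip r)" if "r \<noteq> 0" "\<not> sim \<mu> (flip r) (\<lambda>_. 1)" for r
    using adm(1)[OF that(1)] that(2) unfolding admissible_def by blast
  \<comment> \<open>A full line of zeros would put \<open>0\<close> into a pair of points of total
    mass 1 / 4.\<close>
  have no_line: "charfun \<mu> (y + z) \<noteq> 0" if yz: "charfun \<mu> y = 0" "charfun \<mu> z = 0" "y \<noteq> z" for y z
  proof
    assume yz': "charfun \<mu> (y + z) = 0"
    have "y \<noteq> 0" "z \<noteq> 0" using yz by auto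
    then obtain k where "\<And>u. character u k = (if u \<in> {0, y, z, y + z} then 1 else - 1)"
      using ex_character_span[of y z] yz(3) by blast
    then have "charfun \<mu> u = 0" if "u \<noteq> 0" "character k u = 1" for u
      using that yz yz' by (auto simp: character_commute[of k] split: if_splits)
    then have "pmf \<mu> 0 + pmf \<mu> (0 + k) = 1 / 4" using sum_quarter_iff by blast
    then show False using large pmf_nonneg[of \<mu> "0 + k"] by linarith
  qed
  consider (three) x y z where "charfun \<mu> x = 0" "charfun \<mu> y = 0" "charfun \<mu> z = 0" "x \<noteq> y" "z \<notin> {x, y, x + y}"
    | (two) x y where "charfun \<mu> x = 0" "charfun \<mu> y = 0" "x \<noteq> y"
        "\<And>z. charfun \<mu> z = 0 \<Longrightarrow> z \<in> {x, y}"
    | (one) s where "charfun \<mu> s = 0" "\<And>z. charfun \<mu> z = 0 \<Longrightarrow> z = s"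
    | (none) "\<And>z. charfun \<mu> z \<noteq> 0"
    using no_line by (metis insert_iff singletonD)
  then show ?thesis
  proof cases
    case three
    have nz: "x \<noteq> 0" "y \<noteq> 0" "z \<noteq> 0" using three by auto
    have xyz: "x + y \<noteq> 0" "x + z \<noteq> 0" "x + y \<noteq> x + z" using three by auto
    \<comment> \<open>Three noncollinear zeros have sums \<open>x + y\<close>, \<open>x + z\<close>
      and \<open>y + z\<close> forming a line. The character trivial on it is \<open>- 1\<close> at
      the three zeros and at the fourth point \<open>x + y + z\<close>.\<close>
    obtain g where g: "\<And>u. character u g = (if u \<in> {0, x + y, x + z, (x + y) + (x + z)} then 1 else - 1)"
      using ex_character_span[OF xyz] by blast
    have yz: "(x + y) + (x + z) = y + z" by (simp add: add.assoc add.left_commute[of y])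
    have "x = y + z \<longleftrightarrow> z = x + y" by (metis add_add_self_z23 add.commute)
    then have gx: "character g x = - 1"
      using nz three by (auto simp: character_commute[of g] g yz)
    have gxy: "character g (x + y) = 1" "character g (x + z) = 1"
      by (simp_all add: character_commute[of g] g)
    then have gy: "character g y = - 1" "character g z = - 1" using gx by (simp_all add: character_add_right)
    define s where "s = x + y + z"
    have s: "character g s = - 1" by (simp add: s_def character_add_right gx gy)
    have "charfun \<mu> u = 0" if u: "u \<noteq> s" "character g u = - 1" for u
    proof -
      have "character (u + x) g = 1" using u gx by (simp add: character_commute[of _ g] character_add_right)
      then have "u + x \<in> {0, x + y, x + z, y + z}" unfolding g yz by (simp split: if_splits)
      then have "u = x \<or> u = y \<or> u = z \<or> u = s"
        by (auto simp: add_eq_iff_z23[of u x] s_def add.assoc add.left_commute add.commute)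
      then show ?thesis using u three by auto
    qed
    moreover have "\<not> feasible \<mu> (coflip r)" if r: "character g r = - 1" for r
    proof (rule infC)
      show "r \<noteq> 0" using r by auto
      \<comment> \<open>The line of pairwise sums consists of nonzeros of
        \<open>charfun \<mu>\<close> by \<open>no_line\<close> and misses \<open>r\<close>.\<close>
      have "r \<notin> {x + y, x + z, (x + y) + (x + z)}" using r gxy by (auto simp: character_add_right)
      moreover have "charfun \<mu> (x + y) \<noteq> 0" "charfun \<mu> (x + z) \<noteq> 0" "charfun \<mu> ((x + y) + (x + z)) \<noteq> 0"
        unfolding yz using three no_line[of x y] no_line[of x z] no_line[of y z] by auto
      ultimately show "\<not> sim \<mu> (coflip r) (\<lambda>_. 1)" using not_sim_coflip_one xyz by blast
    qed
    ultimately have "cond_II2 \<mu> {0, g}" unfolding cond_II2_iff using s by blast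
    with s show ?thesis by blast
  next
    case two
    define s where "s = x + y"
    have nz: "x \<noteq> 0" "y \<noteq> 0" "s \<noteq> 0" using two(1-3) by (auto simp: s_def)
    then obtain g where g: "character g s = - 1" using ex_character_neg by blast
    have inf: "\<not> feasible \<mu> (coflip r)" if r: "r \<noteq> 0" "r \<noteq> s" for r
    proof (rule infC[OF r(1)])
      obtain v where v: "v \<notin> {0, x, y, x + y}" by (rule exE[OF ex_z23_notin4])
      \<comment> \<open>The line of \<open>x + w\<close>, \<open>y + w\<close> and
        \<open>x + y\<close> avoids \<open>x\<close>, \<open>y\<close> and \<open>w\<close>; the
        choice of \<open>w\<close> puts \<open>r\<close> among these three.\<close>
      define w where "w = (if r = x \<or> r = y then v else r)"
      have w: "w \<notin> {0, x, y, x + y}" "r = x \<or> r = y \<or> r = w"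
        using r v by (auto simp: w_def s_def)
      have "(x + w) + (y + w) = x + y" by (simp add: add.assoc add.left_commute)
      moreover have "x + w = y \<longleftrightarrow> w = x + y" "y + w = x \<longleftrightarrow> w = x + y"
        by (rule add_eq_swap_z23, subst add_eq_swap_z23, simp only: add.commute)
      then have "x + w \<notin> {x, y}" "y + w \<notin> {x, y}" "x + y \<notin> {x, y}" using w nz by auto
      then have "charfun \<mu> (x + w) \<noteq> 0" "charfun \<mu> (y + w) \<noteq> 0" "charfun \<mu> (x + y) \<noteq> 0"
        using two(4) by blast+
      moreover have "r \<notin> {x + w, y + w, x + y}"
        using w r nz \<open>x + w \<notin> {x, y}\<close> \<open>y + w \<notin> {x, y}\<close> by (auto simp: s_def)
      moreover have "x + w \<noteq> 0" "y + w \<noteq> 0" "x + w \<noteq> y + w" using w two(3) by auto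
      ultimately show "\<not> sim \<mu> (coflip r) (\<lambda>_. 1)" using not_sim_coflip_one[of "x + w" "y + w"] by metis
    qed
    have "x \<noteq> s" "x + s = y" using nz by (auto simp: s_def)
    then have zeros: "\<exists>y. y \<noteq> 0 \<and> y \<noteq> s \<and> charfun \<mu> y = 0 \<and> charfun \<mu> (y + s) = 0"
      using nz two(1-2) by (intro exI[of _ x]) simp
    have "cond_II3 \<mu> {0, g} (ker s)"
      unfolding cond_II3_iff[OF g] by (intro conjI zeros allI impI) (elim conjE, rule inf)
    with g show ?thesis by blast
  next
    case one
    have s: "s \<noteq> 0" using one(1) by auto
    then obtain g where g: "character g s = - 1" using ex_character_neg by blast
    have "\<not> feasible \<mu> (coflip r)" if r: "r \<noteq> 0" for r
    proof (rule infC[OF r])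
      obtain a b where ab: "a \<noteq> 0" "b \<noteq> 0" "a \<noteq> b" "r \<notin> {a, b, a + b}" "s \<notin> {a, b, a + b}"
        using ex_line_avoiding[OF r s] by blast
      then have "charfun \<mu> a \<noteq> 0" "charfun \<mu> b \<noteq> 0" "charfun \<mu> (a + b) \<noteq> 0" using one(2) by blast+
      then show "\<not> sim \<mu> (coflip r) (\<lambda>_. 1)" using not_sim_coflip_one ab by blast
    qed
    moreover have "\<not> feasible \<mu> (flip r)" if r: "r \<noteq> 0" "r \<noteq> s" for r
    proof (rule infF[OF r(1)])
      \<comment> \<open>The line through \<open>r\<close> and \<open>b\<close> misses the only zero
        \<open>s\<close>.\<close>
      obtain b where b: "b \<notin> {0, r, s, r + s}" by (rule exE[OF ex_z23_notin4])
      moreover have "r + b = s \<longleftrightarrow> b = r + s" by (rule add_eq_swap_z23)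
      ultimately have "charfun \<mu> r \<noteq> 0" "charfun \<mu> b \<noteq> 0" "charfun \<mu> (r + b) \<noteq> 0" using one(2) r by blast+
      then show "\<not> sim \<mu> (flip r) (\<lambda>_. 1)" using not_sim_flip_one[of r b] b r by blast
    qed
    ultimately have "cond_II4 \<mu> {0, g} (ker s)" unfolding cond_II4_iff[OF g] using one(1) by blast
    with g show ?thesis by blast
  next
    case none
    \<comment> \<open>II.1 does not mention the decomposition, so an arbitrary one is
      supplied.\<close>
    have "(1, 1, 1) \<noteq> (0 :: z23)" by (simp add: zero_prod_def)
    then obtain g where g: "character g (1, 1, 1) = - 1" using ex_character_neg by blast
    have "\<not> feasible \<mu> (coflip r)" if r: "r \<noteq> 0" for r
      using ex_line_avoiding[OF r r] not_sim_coflip_one none infC[OF r] by blast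
    moreover have "\<not> feasible \<mu> (flip r)" if r: "r \<noteq> 0" for r
    proof (rule infF[OF r])
      obtain b where "b \<notin> {0, r, 0, r}" by (rule exE[OF ex_z23_notin4])
      then show "\<not> sim \<mu> (flip r) (\<lambda>_. 1)" using not_sim_flip_one[of r b] none r by blast
    qed
    ultimately have "cond_II1 \<mu>" unfolding cond_II1_iff by blast
    with g show ?thesis by blast
  qed
qed

theorem theorem4:
  fixes \<mu> :: "z23 pmf" and a_max :: real
  assumes "a_max = Max {pmf \<mu> x | x. x \<in> UNIV}"
    and "a_max = pmf \<mu> 0"
  shows "\<mu> \<in> TEC \<longleftrightarrow>
    (\<exists>X1\<in>\<AA>\<^sub>1. \<exists>X2\<in>\<AA>\<^sub>2. direct_sum X1 X2 \<and>
       (a_max \<le> 1 / 4 \<longrightarrow> cond_I1 \<mu> X1 X2 \<and> cond_I2 \<mu> X1 X2) \<and>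
       (a_max > 1 / 4 \<longrightarrow>
          cond_II1 \<mu> \<or> cond_II2 \<mu> X1 \<or> cond_II3 \<mu> X1 X2 \<or> cond_II4 \<mu> X1 X2))"
proof -
  \<comment> \<open>Decompositions are parametrized by pairs of an element \<open>g\<close> and a
    character \<open>s\<close> with value \<open>- 1\<close> at \<open>g\<close>.\<close>
  have decomp: "(\<exists>X1\<in>\<AA>\<^sub>1. \<exists>X2\<in>\<AA>\<^sub>2. direct_sum X1 X2 \<and> P X1 X2)
      \<longleftrightarrow> (\<exists>g s. character g s = - 1 \<and> P {0, g} (ker s))" for P
  proof -
    have "g \<noteq> 0" "s \<noteq> 0" if "character g s = - 1" for g s using that by auto
    then show ?thesis unfolding bex_subgroups1 bex_subgroups2 using direct_sum_iff by metis
  qed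
  have "pmf \<mu> x \<le> a_max" for x
    unfolding assms(1) setcompr_eq_image by (rule Max_ge) auto
  then have max: "pmf \<mu> x \<le> pmf \<mu> 0" for x by (simp add: assms(2))
  show ?thesis
  proof (cases "a_max \<le> 1 / 4")
    case True
    then show ?thesis unfolding decomp using TEC_iff_small[of \<mu>] max assms(2) by auto
  next
    case False
    then have large: "pmf \<mu> 0 > 1 / 4" by (simp add: assms(2))
    then have "\<mu> \<in> TEC \<longleftrightarrow> (\<exists>g s. character g s = - 1 \<and>
      (cond_II1 \<mu> \<or> cond_II2 \<mu> {0, g} \<or> cond_II3 \<mu> {0, g} (ker s) \<or> cond_II4 \<mu> {0, g} (ker s)))"
      using TEC_if_large TEC_only_if_large by blast
    then show ?thesis unfolding decomp using False by simp
  qed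
qed

end
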